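(* Let $k\ge3$. For $a_1,\dots,a_k\ge0$ set $$\mu(a_1,\dots,a_k)=\sup_{\tau\ge0}\left\{\frac12\sum_{j=1}^k\Big(\sqrt{a_j^4+4a_j^2\tau}-a_j^2\Big)-\tau\right\}.$$ Let $\boldsymbol{\lambda}=(\lambda_1,\dots,\lambda_k)\in(0,\infty)^k$, $\lambda_{\min}=\min_j\lambda_j$, $\lambda_{\max}=\max_j\lambda_j$. If $$\sup_{0\le\sigma\le\lambda_{\min}^2}\left\{\frac{(k-1)^2+4}{4}\,\sigma+\mu\Big(\sqrt{\lambda_1^2-\sigma},\dots,\sqrt{\lambda_k^2-\sigma}\Big)\right\}\ \ge\ 2\lambda_{\max}^2,$$ then the generalized helicoid $\mathcal{H}_{\boldsymbol{\lambda}}$ is stable.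
   Context: For $\boldsymbol{\lambda}\in(0,\infty)^k$, the generalized helicoid $\mathcal{H}_{\boldsymbol{\lambda}}\subset\mathbb{C}^k\times\mathbb{R}\cong\mathbb{R}^{2k+1}$ is the $(k+1)$-dimensional minimal submanifold parametrized by $(u_1,\dots,u_k,s)\mapsto(u_1e^{i\lambda_1s},\dots,u_ke^{i\lambda_ks},s)$, $(u,s)\in\mathbb{R}^k\times\mathbb{R}$. The second variation of area in the direction of a smooth compactly supported normal vector field $V$ on a minimal submanifold $M$ of Euclidean space is $$Q(V,V)=\int_{M}\Big(\sum_{a}|\nabla^\perp_{E_a}V|^2-\sum_{a,b}\langle \mathrm{II}(E_a,E_b),V\rangle^2\Big)\,d\mu_M,$$ where $\{E_a\}$ is any local orthonormal tangent frame, $\nabla^\perp$ is the normal connection, and $\mathrm{II}$ is the second fundamental form. $M$ is stable if $Q(V,V)\ge0$ for every such $V$. *)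

theory Defs
  imports "HOL-Analysis.Analysis"
begin

text \<open>
  \<open>C\<^sup>n\<close> and smooth maps on a whole Euclidean space: all iterated directional
  derivatives up to order \<open>n\<close> (resp. of every order) exist and are continuous.
\<close>

primrec ck :: "nat \<Rightarrow> ('a::euclidean_space \<Rightarrow> 'b::euclidean_space) \<Rightarrow> bool" where
  "ck 0 f \<longleftrightarrow> continuous_on UNIV f"
| "ck (Suc n) f \<longleftrightarrow>
     (\<forall>x. f differentiable (at x)) \<and> (\<forall>v. ck n (\<lambda>x. frechet_derivative f (at x) v))"

definition smooth :: "('a::euclidean_space \<Rightarrow> 'b::euclidean_space) \<Rightarrow> bool" where
  "smooth f \<longleftrightarrow> (\<forall>n. ck n f)"

text \<open>
  A submanifold \<open>M\<close> of a Euclidean space \<open>'e\<close> is given by a global parametrization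
  \<open>F\<close> (a smooth injective immersion, homeomorphic onto its image \<open>M\<close>).  A point \<open>F p\<close> of \<open>M\<close>
  is represented by \<open>p\<close>, the tangent vector \<open>dF\<^sub>p v\<close> by \<open>v\<close>, and a vector field along \<open>M\<close>
  with values in \<open>'e\<close> by its composition with \<open>F\<close>.
\<close>

definition tangent_space ::
    "(real^'n \<Rightarrow> 'e::euclidean_space) \<Rightarrow> real^'n \<Rightarrow> 'e set" where
  "tangent_space F p = range (frechet_derivative F (at p))"

definition normal_part ::
    "(real^'n \<Rightarrow> 'e::euclidean_space) \<Rightarrow> real^'n \<Rightarrow> 'e \<Rightarrow> 'e" where
  "normal_part F p w =
     (THE y. y \<in> orthogonal_comp (tangent_space F p) \<and> w - y \<in> tangent_space F p)"

definition normal_connection ::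
    "(real^'n \<Rightarrow> 'e::euclidean_space) \<Rightarrow> (real^'n \<Rightarrow> 'e) \<Rightarrow> real^'n \<Rightarrow> real^'n \<Rightarrow> 'e" where
  "normal_connection F V p v = normal_part F p (frechet_derivative V (at p) v)"

text \<open>
  \<open>II(X, Y)\<close> is the normal part of the ambient derivative along \<open>X\<close> of a tangential extension
  of \<open>Y\<close>; for \<open>Y = dF\<^sub>p w\<close> the extension used is \<open>q \<mapsto> dF\<^sub>q w\<close>.
\<close>

definition second_fundamental_form ::
    "(real^'n \<Rightarrow> 'e::euclidean_space) \<Rightarrow> real^'n \<Rightarrow> real^'n \<Rightarrow> real^'n \<Rightarrow> 'e" where
  "second_fundamental_form F p v w =
     normal_part F p (frechet_derivative (\<lambda>q. frechet_derivative F (at q) w) (at p) v)"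

text \<open>
  The vectors \<open>dF\<^sub>p (e a)\<close>, with \<open>a\<close> ranging over the finite type \<open>'n\<close>, form an orthonormal
  basis of the tangent space.
\<close>

definition orthonormal_frame_at ::
    "(real^'n \<Rightarrow> 'e::euclidean_space) \<Rightarrow> real^'n \<Rightarrow> ('n \<Rightarrow> real^'n) \<Rightarrow> bool" where
  "orthonormal_frame_at F p e \<longleftrightarrow>
     (\<forall>a b. frechet_derivative F (at p) (e a) \<bullet> frechet_derivative F (at p) (e b)
              = (if a = b then 1 else 0))"

definition second_variation_density ::
    "(real^'n \<Rightarrow> 'e::euclidean_space) \<Rightarrow> (real^'n \<Rightarrow> 'e) \<Rightarrow> real^'n \<Rightarrow> ('n \<Rightarrow> real^'n) \<Rightarrow> real" where
  "second_variation_density F V p e =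
     (\<Sum>a\<in>UNIV. (norm (normal_connection F V p (e a)))\<^sup>2)
     - (\<Sum>a\<in>UNIV. \<Sum>b\<in>UNIV. (second_fundamental_form F p (e a) (e b) \<bullet> V p)\<^sup>2)"

text \<open>Density of the induced volume measure \<open>\<mu>\<^sub>M\<close> in the coordinates \<open>F\<close>.\<close>

definition volume_density :: "(real^'n \<Rightarrow> 'e::euclidean_space) \<Rightarrow> real^'n \<Rightarrow> real" where
  "volume_density F p =
     sqrt (det (\<chi> i j. frechet_derivative F (at p) (axis i 1)
                        \<bullet> frechet_derivative F (at p) (axis j 1)))"

text \<open>
  The density at \<open>p\<close> is the same for every orthonormal basis of the tangent space, so the choice
  of frame below is immaterial; for an immersion a frame exists at every point.
\<close>

definition second_variation ::
    "(real^'n \<Rightarrow> 'e::euclidean_space) \<Rightarrow> (real^'n \<Rightarrow> 'e) \<Rightarrow> real" where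
  "second_variation F V =
     (LINT p|lborel.
        second_variation_density F V p (SOME e. orthonormal_frame_at F p e) * volume_density F p)"

definition compactly_supported_normal_field ::
    "(real^'n \<Rightarrow> 'e::euclidean_space) \<Rightarrow> (real^'n \<Rightarrow> 'e) \<Rightarrow> bool" where
  "compactly_supported_normal_field F V \<longleftrightarrow>
     smooth V \<and> compact (closure {p. V p \<noteq> 0})
     \<and> (\<forall>p. V p \<in> orthogonal_comp (tangent_space F p))"

definition stable_submanifold :: "(real^'n \<Rightarrow> 'e::euclidean_space) \<Rightarrow> bool" where
  "stable_submanifold F \<longleftrightarrow> (\<forall>V. compactly_supported_normal_field F V \<longrightarrow> 0 \<le> second_variation F V)"

text \<open>
  The parameter \<open>(u, s) \<in> \<real>\<^sup>k \<times> \<real>\<close> is encoded as a vector \<open>x\<close> indexed by \<open>'k option\<close>: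
  \<open>u\<^sub>j = x $ Some j\<close> and \<open>s = x $ None\<close>.
\<close>

definition helicoid :: "real^'k \<Rightarrow> real^('k option) \<Rightarrow> (complex^'k) \<times> real" where
  "helicoid lam x =
     ((\<chi> j. complex_of_real (x $ Some j) * exp (\<i> * complex_of_real (lam $ j * x $ None))), x $ None)"

definition mu :: "real^'k \<Rightarrow> real" where
  "mu a = (SUP \<tau>\<in>{0..}.
     (1/2) * (\<Sum>j\<in>UNIV. sqrt ((a $ j)^4 + 4 * (a $ j)\<^sup>2 * \<tau>) - (a $ j)\<^sup>2) - \<tau>)"

end

theory Submission
  imports Defs
begin

text \<open>
  In the coordinates \<open>y\<^sub>j = \<lambda>\<^sub>j u\<^sub>j\<close> the volume density is \<open>W = sqrt (1 + |y|\<^sup>2)\<close>, and a normal field is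
  \<open>V = (f, - y \<bullet> f)\<close> in the frame formed by \<open>\<i> e\<^sup>i\<^sup>\<lambda>\<^sup>s\<close> in each factor and the vertical direction.
  After dropping the derivative along the axis, the second variation is bounded below by the
  integral of \<open>W (\<Sum>\<^sub>i \<lambda>\<^sub>i\<^sup>2 |\<nabla>\<^sub>i V|\<^sup>2) - 2 (\<Sum>\<^sub>j \<lambda>\<^sub>j\<^sup>2 f\<^sub>j\<^sup>2) / W\<close>, with \<open>\<nabla>\<^sub>i\<close> taken along \<open>\<partial>/\<partial>y\<^sub>i\<close>.
  Write \<open>\<lambda>\<^sub>i\<^sup>2 = (\<lambda>\<^sub>i\<^sup>2 - \<sigma>) + \<sigma>\<close>. The first part is treated by a Hardy inequality: complete the
  square with \<open>\<nabla>\<^sub>i + \<beta>\<^sub>i y\<^sub>i / W\<^sup>2\<close>, where \<open>(\<lambda>\<^sub>i\<^sup>2 - \<sigma>) (\<beta>\<^sub>i + \<beta>\<^sub>i\<^sup>2) = \<tau>\<close>; optimizing over \<open>\<tau>\<close> yields \<open>\<mu>\<close>.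
  The second part is rotationally symmetric. The same square with \<open>\<beta> = (k - 1)/2\<close> gives \<open>(k - 1)\<^sup>2/4\<close>,
  and the extra \<open>1\<close> comes from a Bochner argument on the spheres \<open>|y| = const\<close>: the quadratic form
  \<open>(tr T)\<^sup>2 - tr T\<^sup>2\<close> of the tangential derivative \<open>T\<close> is a divergence up to lower order terms.
  All integrations by parts reduce to \<open>\<integral> \<partial>J = 0\<close>, so only pointwise algebra remains.
\<close>

section \<open>Derivatives in a fixed direction\<close>

text \<open>The derivative is taken along one direction at every point of the space, so product,
  chain and mean value rules are those of one real variable.\<close>

definition has_dir_deriv :: "('a::real_normed_vector \<Rightarrow> real) \<Rightarrow> ('a \<Rightarrow> real) \<Rightarrow> 'a \<Rightarrow> bool" where
  "has_dir_deriv g g' v \<longleftrightarrow> (\<forall>x. ((\<lambda>t. g (x + t *\<^sub>R v)) has_real_derivative g' x) (at 0))"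

lemma has_dir_deriv_line:
  assumes "has_dir_deriv g g' v"
  shows "((\<lambda>t. g (x + t *\<^sub>R v)) has_real_derivative g' (x + t *\<^sub>R v)) (at t)"
proof -
  have "((\<lambda>s. g ((x + t *\<^sub>R v) + s *\<^sub>R v)) has_real_derivative g' (x + t *\<^sub>R v)) (at 0)"
    using assms unfolding has_dir_deriv_def by blast
  then have "((\<lambda>s. g (x + (t + s) *\<^sub>R v)) has_real_derivative g' (x + t *\<^sub>R v)) (at 0)"
    by (simp add: algebra_simps)
  then have "((\<lambda>s. g (x + s *\<^sub>R v)) has_real_derivative g' (x + t *\<^sub>R v)) (at (t + 0))"
    by (subst DERIV_shift[where z = t and x = 0, unfolded add.commute[of 0]]) (simp add: add.commute)
  then show ?thesis by simp
qed

lemma dir_deriv_mvt: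
  assumes "has_dir_deriv g g' v" "h > 0"
  obtains s where "0 < s" "s < h" "g (x + h *\<^sub>R v) - g x = h * g' (x + s *\<^sub>R v)"
proof -
  have "\<exists>z>0. z < h \<and> g (x + h *\<^sub>R v) - g (x + 0 *\<^sub>R v) = (h - 0) * g' (x + z *\<^sub>R v)"
    using assms by (intro MVT2 has_dir_deriv_line) auto
  then show ?thesis using that by auto
qed

lemma has_dir_deriv_unique:
  assumes "has_dir_deriv g a v" "has_dir_deriv g b v"
  shows "a x = b x"
  using assms DERIV_unique unfolding has_dir_deriv_def by blast

section \<open>Integrals of derivatives of functions with bounded support\<close>

lemma integrable_bounded_support:
  fixes g :: "'a::euclidean_space \<Rightarrow> real"
  assumes "continuous_on UNIV g" "bounded {x. g x \<noteq> 0}"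
  shows "integrable lborel g"
proof -
  obtain R where R: "\<And>x. g x \<noteq> 0 \<Longrightarrow> norm x \<le> R"
    using assms(2) unfolding bounded_iff by auto
  have "integrable lborel (\<lambda>x. indicator (cball 0 R) x *\<^sub>R g x)"
    by (intro borel_integrable_compact continuous_on_subset[OF assms(1)]) auto
  moreover have "(\<lambda>x. indicator (cball 0 R) x *\<^sub>R g x) = g"
    using R by (auto simp: fun_eq_iff indicator_def)
  ultimately show ?thesis by simp
qed

text \<open>The difference quotients of \<open>J\<close> have integral 0 by translation invariance
  of Lebesgue measure. They converge pointwise to \<open>D\<close> and are dominated by a constant
  on a fixed ball, by the mean value theorem.\<close>

lemma integral_dir_deriv_eq_0:
  fixes J D :: "'a::euclidean_space \<Rightarrow> real"
  assumes der: "has_dir_deriv J D v" and J: "continuous_on UNIV J" and D: "continuous_on UNIV D"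
    and bd: "bounded {x. J x \<noteq> 0}"
  shows "integrable lborel D" "integral\<^sup>L lborel D = 0"
proof -
  obtain R where R: "\<And>x. J x \<noteq> 0 \<Longrightarrow> norm x \<le> R"
    using bd unfolding bounded_iff by auto
  \<comment> \<open>For steps \<open>h n \<le> 1\<close> the quotient vanishes outside the ball of
    radius \<open>R'\<close>. The intermediate point of the mean value theorem may lie another
    \<open>norm v\<close> further out, hence the radius used for \<open>M\<close>.\<close>
  define R' where "R' = R + norm v"
  define h where "h n = 1 / (real n + 1)" for n
  have h: "0 < h n" "h n \<le> 1" for n by (auto simp: h_def field_simps)
  define s where "s n x = (J (x + h n *\<^sub>R v) - J x) / h n" for n x
  have "bounded (D ` cball 0 (R' + norm v))"
    by (intro compact_imp_bounded compact_continuous_image continuous_on_subset[OF D]) auto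
  then obtain M where M: "\<And>x. norm x \<le> R' + norm v \<Longrightarrow> norm (D x) \<le> M"
    unfolding bounded_iff by (metis imageI mem_cball_0)
  have bound: "norm (s n x) \<le> indicator (cball 0 R') x *\<^sub>R M" for n x
  proof (cases "norm x \<le> R'")
    case True
    obtain r where r: "0 < r" "r < h n" "J (x + h n *\<^sub>R v) - J x = h n * D (x + r *\<^sub>R v)"
      using dir_deriv_mvt[OF der h(1)] by blast
    have "r * norm v \<le> 1 * norm v" using r h(2)[of n] by (intro mult_right_mono) auto
    then have "norm (x + r *\<^sub>R v) \<le> R' + norm v"
      using True r norm_triangle_ineq[of x "r *\<^sub>R v"] by simp
    then show ?thesis using M r h(1)[of n] True by (auto simp: s_def)
  next
    case False
    have "h n * norm v \<le> 1 * norm v" using h[of n] by (intro mult_right_mono) auto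
    then have "norm (h n *\<^sub>R v) \<le> norm v" using h(1)[of n] by simp
    moreover have "norm x \<le> norm (x + h n *\<^sub>R v) + norm (h n *\<^sub>R v)"
      by (metis add_diff_cancel_right' norm_triangle_ineq4)
    ultimately have "norm (x + h n *\<^sub>R v) > R" using False unfolding R'_def by linarith
    then have "J (x + h n *\<^sub>R v) = 0" using R[of "x + h n *\<^sub>R v"] by force
    moreover have "norm x > R" using False norm_ge_zero[of v] unfolding R'_def by linarith
    then have "J x = 0" using R[of x] by force
    ultimately show ?thesis using False by (simp add: s_def)
  qed
  have Jint: "integrable lborel J"
    by (rule integrable_bounded_support[OF J bd])
  have Jshift: "integrable lborel (\<lambda>x. J (x + c)) \<and> integral\<^sup>L lborel (\<lambda>x. J (x + c)) = integral\<^sup>L lborel J" for c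
  proof -
    have [measurable]: "J \<in> borel_measurable borel"
      using J by (simp add: borel_measurable_continuous_onI)
    have "integral\<^sup>L lborel J = integral\<^sup>L (distr lborel borel ((+) c)) J" by (simp only: lborel_distr_plus)
    also have "\<dots> = integral\<^sup>L lborel (\<lambda>x. J (c + x))" by (subst integral_distr) auto
    finally have 1: "integral\<^sup>L lborel J = integral\<^sup>L lborel (\<lambda>x. J (c + x))" .
    have "integrable (distr lborel borel ((+) c)) J" using Jint by (simp only: lborel_distr_plus)
    then have "integrable lborel (\<lambda>x. J (c + x))" by (subst (asm) integrable_distr_eq) auto
    then show ?thesis using 1 by (simp add: add.commute)
  qed
  have sint: "integral\<^sup>L lborel (s n) = 0" for n
    unfolding s_def using Jint Jshift by (simp)
  have h0: "filterlim h (at 0) sequentially"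
    unfolding filterlim_at
  proof
    show "h \<longlonglongrightarrow> 0" using LIMSEQ_inverse_real_of_nat by (simp add: h_def[abs_def] inverse_eq_divide add.commute)
    show "\<forall>\<^sub>F x in sequentially. h x \<in> UNIV \<and> h x \<noteq> 0" using h(1) by (simp add: less_imp_neq[symmetric])
  qed
  have lim: "(\<lambda>n. s n x) \<longlonglongrightarrow> D x" for x
  proof -
    have "((\<lambda>t. (J (x + t *\<^sub>R v) - J (x + 0 *\<^sub>R v)) / (t - 0)) \<longlongrightarrow> D x) (at 0)"
      using der unfolding has_dir_deriv_def has_field_derivative_iff by blast
    from filterlim_compose[OF this h0] show ?thesis by (simp add: s_def)
  qed
  have meas [measurable]: "J \<in> borel_measurable borel" "D \<in> borel_measurable borel"
    using J D by (simp_all add: borel_measurable_continuous_onI)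
  have smeas: "s n \<in> borel_measurable lborel" for n
    unfolding s_def by measurable
  have w: "integrable lborel (\<lambda>x::'a. indicator (cball 0 R') x *\<^sub>R M)"
    by (intro borel_integrable_compact) auto
  show "integrable lborel D"
    by (rule integrable_dominated_convergence[where s = s, OF _ _ w]) (use lim bound smeas meas in auto)
  have "(\<lambda>n. integral\<^sup>L lborel (s n)) \<longlonglongrightarrow> integral\<^sup>L lborel D"
    by (rule integral_dominated_convergence[where s = s, OF _ _ w]) (use lim bound smeas meas in auto)
  then show "integral\<^sup>L lborel D = 0" using sint LIMSEQ_unique by (auto simp: LIMSEQ_const_iff)
qed

section \<open>Symmetry of mixed derivatives\<close>

lemma second_difference:
  assumes "has_dir_deriv g a v" "has_dir_deriv a ab w" "h > 0"
  obtains s r where "0 < s" "s < h" "0 < r" "r < h"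
    "g (x + h *\<^sub>R v + h *\<^sub>R w) - g (x + h *\<^sub>R v) - g (x + h *\<^sub>R w) + g x = h * h * ab (x + s *\<^sub>R v + r *\<^sub>R w)"
proof -
  define p where "p y = g (y + h *\<^sub>R w) - g y" for y
  have "has_dir_deriv p (\<lambda>y. a (y + h *\<^sub>R w) - a y) v"
    unfolding has_dir_deriv_def
  proof
    fix y
    have "((\<lambda>t. g ((y + h *\<^sub>R w) + t *\<^sub>R v)) has_real_derivative a (y + h *\<^sub>R w)) (at 0)"
      "((\<lambda>t. g (y + t *\<^sub>R v)) has_real_derivative a y) (at 0)"
      using assms(1) unfolding has_dir_deriv_def by blast+
    from DERIV_diff[OF this] show "((\<lambda>t. p (y + t *\<^sub>R v)) has_real_derivative a (y + h *\<^sub>R w) - a y) (at 0)"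
      by (simp add: p_def algebra_simps)
  qed
  then obtain s where s: "0 < s" "s < h"
    "p (x + h *\<^sub>R v) - p x = h * (a (x + s *\<^sub>R v + h *\<^sub>R w) - a (x + s *\<^sub>R v))"
    using dir_deriv_mvt[OF _ assms(3)] by (metis (no_types, lifting))
  obtain r where r: "0 < r" "r < h"
    "a (x + s *\<^sub>R v + h *\<^sub>R w) - a (x + s *\<^sub>R v) = h * ab (x + s *\<^sub>R v + r *\<^sub>R w)"
    using dir_deriv_mvt[OF assms(2,3)] by metis
  show ?thesis by (rule that[OF s(1,2) r(1,2)]) (use s r in \<open>simp add: p_def\<close>)
qed

text \<open>The second difference of \<open>g\<close> is symmetric in \<open>v\<close> and
  \<open>w\<close>, so \<open>ab\<close> at one point near \<open>x\<close> equals \<open>ba\<close>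
  at another. Continuity of both then forces equality at \<open>x\<close>.\<close>

lemma mixed_dir_derivs_commute:
  fixes g :: "'a::real_normed_vector \<Rightarrow> real"
  assumes "has_dir_deriv g a v" "has_dir_deriv a ab w" "has_dir_deriv g b w" "has_dir_deriv b ba v"
    and "continuous_on UNIV ab" "continuous_on UNIV ba"
  shows "ab x = ba x"
proof (rule ccontr)
  assume ne: "ab x \<noteq> ba x"
  define e where "e = dist (ab x) (ba x) / 2"
  have e: "e > 0" using ne by (simp add: e_def)
  obtain d1 where d1: "d1 > 0" "\<And>y. dist y x < d1 \<Longrightarrow> dist (ab y) (ab x) < e"
    using assms(5) e by (metis UNIV_I continuous_on_iff)
  obtain d2 where d2: "d2 > 0" "\<And>y. dist y x < d2 \<Longrightarrow> dist (ba y) (ba x) < e"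
    using assms(6) e by (metis UNIV_I continuous_on_iff)
  \<comment> \<open>All points reached with steps below \<open>h\<close> are closer to
    \<open>x\<close> than \<open>d1\<close> and \<open>d2\<close>. The summand 1 keeps the
    denominator positive when both directions vanish.\<close>
  define h where "h = min d1 d2 / (norm v + norm w + 1)"
  have h: "h > 0" using d1 d2 by (auto simp: h_def intro!: divide_pos_pos add_nonneg_pos)
  have near: "dist (x + s *\<^sub>R v + r *\<^sub>R w) x < min d1 d2" if "0 < s" "s < h" "0 < r" "r < h" for s r
  proof -
    have "dist (x + s *\<^sub>R v + r *\<^sub>R w) x = norm (s *\<^sub>R v + r *\<^sub>R w)"
      by (simp add: dist_norm)
    also have "\<dots> \<le> s * norm v + r * norm w" using that norm_triangle_ineq[of "s *\<^sub>R v" "r *\<^sub>R w"] by simp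
    also have "\<dots> \<le> h * norm v + h * norm w" using that by (intro add_mono mult_right_mono) auto
    also have "\<dots> < h * (norm v + norm w + 1)" using h by (simp add: algebra_simps)
    also have "\<dots> = min d1 d2"
      by (simp add: h_def add_nonneg_pos less_imp_neq[symmetric])
    finally show ?thesis .
  qed
  obtain s r where 1: "0 < s" "s < h" "0 < r" "r < h"
    "g (x + h *\<^sub>R v + h *\<^sub>R w) - g (x + h *\<^sub>R v) - g (x + h *\<^sub>R w) + g x = h * h * ab (x + s *\<^sub>R v + r *\<^sub>R w)"
    using second_difference[OF assms(1,2) h, of x] by blast
  obtain s' r' where 2: "0 < s'" "s' < h" "0 < r'" "r' < h"
    "g (x + h *\<^sub>R w + h *\<^sub>R v) - g (x + h *\<^sub>R w) - g (x + h *\<^sub>R v) + g x = h * h * ba (x + s' *\<^sub>R w + r' *\<^sub>R v)"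
    using second_difference[OF assms(3,4) h, of x] by blast
  have "x + h *\<^sub>R w + h *\<^sub>R v = x + h *\<^sub>R v + h *\<^sub>R w" by (simp add: algebra_simps)
  with 1(5) 2(5) have "h * h * ab (x + s *\<^sub>R v + r *\<^sub>R w) = h * h * ba (x + s' *\<^sub>R w + r' *\<^sub>R v)"
    by (simp add: algebra_simps)
  then have eq: "ab (x + s *\<^sub>R v + r *\<^sub>R w) = ba (x + r' *\<^sub>R v + s' *\<^sub>R w)"
    using h by (simp add: add.commute add.left_commute)
  have "dist (ab (x + s *\<^sub>R v + r *\<^sub>R w)) (ab x) < e" using near[OF 1(1-4)] d1(2) by simp
  moreover have "dist (ba (x + r' *\<^sub>R v + s' *\<^sub>R w)) (ba x) < e" using near[OF 2(3,4,1,2)] d2(2) by simp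
  ultimately have "dist (ab x) (ba x) < e + e"
    using eq dist_triangle_less_add by (metis dist_commute)
  then show False unfolding e_def by simp
qed

section \<open>The pointwise tangential inequality\<close>

definition outer :: "real^'n \<Rightarrow> real^'n \<Rightarrow> real^'n^'n" where
  "outer a b = (\<chi> i j. a $ i * b $ j)"

lemma trace_outer: "trace (outer a b) = a \<bullet> b"
  by (simp add: trace_def outer_def inner_vec_def)

lemma matrix_mul_outer: "A ** outer a b = outer (A *v a) b"
  by (simp add: vec_eq_iff outer_def matrix_matrix_mult_def matrix_vector_mult_def sum_distrib_right mult.assoc)

lemma outer_matrix_mul: "outer a b ** A = outer a (b v* A)"
  by (simp add: vec_eq_iff outer_def matrix_matrix_mult_def vector_matrix_mult_def sum_distrib_left mult.assoc mult.left_commute)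

lemma outer_mult_vector: "outer a b *v c = (b \<bullet> c) *\<^sub>R a"
  by (simp add: vec_eq_iff outer_def matrix_vector_mult_def inner_vec_def sum_distrib_left sum_distrib_right mult_ac)

lemma vector_mult_outer: "c v* outer a b = (c \<bullet> a) *\<^sub>R b"
  by (simp add: vec_eq_iff outer_def vector_matrix_mult_def inner_vec_def sum_distrib_left sum_distrib_right mult_ac)

lemma inner_matrix_eq_trace: "A \<bullet> B = trace (transpose A ** (B :: real^'n^'n))"
  unfolding inner_vec_def trace_def matrix_matrix_mult_def transpose_def
  by simp (rule sum.swap)

lemma trace_transpose: "trace (transpose A) = trace (A :: real^'n^'n)"
  by (simp add: trace_def transpose_def)

lemma matrix_mul_diff_left: "A ** (B - C) = A ** B - A ** (C :: real^'n^'n)"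
  by (simp add: vec_eq_iff matrix_matrix_mult_def sum_subtractf right_diff_distrib)

lemma matrix_mul_diff_right: "(A - B) ** C = A ** C - B ** (C :: real^'n^'n)"
  by (simp add: vec_eq_iff matrix_matrix_mult_def sum_subtractf left_diff_distrib)

lemma matrix_mul_add_right: "(A + B) ** C = A ** C + B ** (C :: real^'n^'n)"
  by (simp add: vec_eq_iff matrix_matrix_mult_def sum.distrib distrib_right)

lemma matrix_mul_scaleR: "(c *\<^sub>R A) ** B = c *\<^sub>R (A ** B)" "A ** (c *\<^sub>R B) = c *\<^sub>R (A ** (B :: real^'n^'n))"
  by (simp_all add: vec_eq_iff matrix_matrix_mult_def sum_distrib_left mult_ac)

text \<open>With X = |T|^2, Z = tr T^2, t = tr T and q = g/(n-1), the difference w X - q (t^2 - Z) -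
  (w - g) t^2/n equals (w + q)/2 (X + Z - 2 t^2/n) + (w - q)/2 (X - Z). The two brackets are squared
  norms of the trace-free symmetric and of the antisymmetric part of \<open>T\<close>, up to
  factors; moreover |T| \<le> |D|.\<close>

lemma projected_trace_inequality:
  fixes D P T :: "real^'n^'n" and n w g :: real
  assumes P: "P ** P = P" "transpose P = P" "trace P = n"
    and T: "T = P ** D ** P" and n: "n \<ge> 2" and g: "0 \<le> g" "g \<le> w"
  shows "w * (D \<bullet> D) - g / (n - 1) * ((trace T)\<^sup>2 - trace (T ** T)) \<ge> (w - g) / n * (trace T)\<^sup>2"
proof -
  let ?S = "transpose T"
  define X where "X = T \<bullet> T"
  define Z where "Z = trace (T ** T)"
  define t where "t = trace T"
  have TT: "?S = P ** transpose D ** P"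
    by (simp add: T matrix_transpose_mul P matrix_mul_assoc)
  have PT: "P ** T = T" "T ** P = T" "P ** ?S = ?S" "?S ** P = ?S"
    unfolding TT unfolding T by (simp_all add: P(1) matrix_mul_assoc) (simp_all add: P(1) matrix_mul_assoc[symmetric])
  \<comment> \<open>Cyclicity of the trace and \<open>P ** P = P\<close> show that
    \<open>D - T\<close> is orthogonal to \<open>T\<close>, so compression does not increase the
    norm.\<close>
  have "D \<bullet> T = trace (transpose D ** P ** D ** P)"
    by (simp add: inner_matrix_eq_trace T matrix_mul_assoc)
  also have "\<dots> = trace (P ** (transpose D ** P ** D))"
    by (subst trace_mul_sym) (simp add: matrix_mul_assoc)
  also have "\<dots> = trace (?S ** D)" by (simp add: TT matrix_mul_assoc)
  also have "\<dots> = trace ((?S ** P) ** D)" by (simp only: PT)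
  also have "\<dots> = trace (P ** D ** ?S)" by (subst trace_mul_sym[symmetric]) (simp add: matrix_mul_assoc)
  also have "\<dots> = trace (P ** D ** (P ** ?S))" by (simp only: PT)
  also have "\<dots> = trace (?S ** T)" by (subst trace_mul_sym) (simp add: T matrix_mul_assoc)
  finally have DT: "D \<bullet> T = X" by (simp add: X_def inner_matrix_eq_trace)
  have "0 \<le> (D - T) \<bullet> (D - T)" by simp
  then have 1: "X \<le> D \<bullet> D"
    using DT by (simp add: inner_diff inner_commute X_def)
  have TS: "T \<bullet> ?S = Z" "?S \<bullet> T = Z"
    by (simp_all add: inner_matrix_eq_trace Z_def inner_commute) (metis matrix_transpose_mul trace_transpose)
  have SS: "?S \<bullet> ?S = X"
    by (simp add: inner_matrix_eq_trace X_def) (rule trace_mul_sym)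
  have TP: "T \<bullet> P = t" "?S \<bullet> P = t"
    using PT by (simp_all add: inner_matrix_eq_trace t_def trace_transpose)
  then have PT': "P \<bullet> T = t" "P \<bullet> ?S = t" by (simp_all only: inner_commute)
  have PP: "P \<bullet> P = n" using P by (simp add: inner_matrix_eq_trace)
  have "0 \<le> (T - ?S) \<bullet> (T - ?S)" by simp
  then have 2: "0 \<le> X - Z"
    using TS SS by (simp add: inner_diff_left inner_diff_right X_def[symmetric])
  have "0 \<le> (T + ?S - (2 * t / n) *\<^sub>R P) \<bullet> (T + ?S - (2 * t / n) *\<^sub>R P)" by simp
  also have "\<dots> = 2 * X + 2 * Z - 4 * t * (2 * t / n) + (2 * t / n)\<^sup>2 * n"
    using TS SS TP PP PT'
    by (simp add: inner_diff_left inner_diff_right inner_add_left inner_add_right X_def[symmetric] power2_eq_square)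
  also have "\<dots> = 2 * X + 2 * Z - 4 * t\<^sup>2 / n"
    using n by (simp add: field_simps power2_eq_square)
  finally have 3: "0 \<le> X + Z - 2 * t\<^sup>2 / n" by simp
  define q where "q = g / (n - 1)"
  define u where "u = t\<^sup>2 / n"
  \<comment> \<open>Here \<open>n \<ge> 2\<close> gives \<open>q \<le> g \<le> w\<close>, so both
    weights (w + q)/2 and (w - q)/2 are nonnegative.\<close>
  have q: "0 \<le> q" "q \<le> g" using n g divide_left_mono[of 1 "n - 1" g] by (auto simp: q_def)
  have "0 \<le> (w + q) / 2 * (X + Z - 2 * u)"
    using 3 q g by (intro mult_nonneg_nonneg) (auto simp: u_def)
  moreover have "0 \<le> (w - q) / 2 * (X - Z)"
    using 2 q g by (intro mult_nonneg_nonneg) auto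
  ultimately have "0 \<le> w * X + q * Z - (w + q) * u"
    by (simp add: algebra_simps)
  also have "\<dots> = w * X - q * (t\<^sup>2 - Z) - (w - g) / n * t\<^sup>2"
  proof -
    have t: "t\<^sup>2 = n * u" and g': "g = (n - 1) * q" using n by (simp_all add: u_def q_def)
    have "(w - g) / n * t\<^sup>2 = (w - g) * u" by (simp add: u_def)
    then show ?thesis unfolding t unfolding g' by (simp only:) (simp add: algebra_simps)
  qed
  finally have "(w - g) / n * t\<^sup>2 \<le> w * X - q * (t\<^sup>2 - Z)" by simp
  also have "\<dots> \<le> w * (D \<bullet> D) - q * (t\<^sup>2 - Z)"
    using 1 g by (simp add: mult_left_mono)
  finally show ?thesis by (simp add: t_def Z_def q_def)
qed

lemma quadratic_form_nonneg:
  fixes a b c :: real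
  assumes "a > 0" "b\<^sup>2 \<le> a * c"
  shows "0 \<le> a * t\<^sup>2 + 2 * b * t + c"
proof -
  have "0 \<le> (a * t + b)\<^sup>2 + (a * c - b\<^sup>2)" using assms(2) by simp
  also have "\<dots> = a * (a * t\<^sup>2 + 2 * b * t + c)" by (simp add: power2_eq_square algebra_simps)
  finally show ?thesis using assms(1) by (simp add: zero_le_mult_iff)
qed

text \<open>In the application m = k - 1, x = |y|^2, z = y . f and t = tr T, so that
  \<open>kap\<close> is (k^2 - 1)/4. Replacing \<open>ff\<close> by its Cauchy-Schwarz lower bound
  leaves a quadratic form in t and z, whose discriminant is checked.\<close>

lemma tangential_remainder_nonneg:
  fixes m x z t ff :: real
  assumes m: "m \<ge> 2" and x: "x > 0" and ff: "ff \<ge> z\<^sup>2 / x"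
  defines "kap \<equiv> (m\<^sup>2 + 2 * m) / 4"
  shows "0 \<le> (2 * x + 1) / m * t\<^sup>2 + 2 * z * x * t + (kap - 1) * ff + (kap - (m + 1) + m\<^sup>2 * (1 + x) / 4) * z\<^sup>2"
proof -
  have mm: "m * m \<ge> 2 * m" "m * m \<ge> 4" using m mult_mono[of 2 m 2 m] by (auto intro: mult_right_mono)
  have k1: "kap - 1 \<ge> 0" using mm m by (simp add: kap_def power2_eq_square)
  have k2: "kap - (m + 1) + m\<^sup>2 / 4 \<ge> 0"
  \<comment> \<open>The left side equals (m - 2)(m + 1)/2; it vanishes at m = 2, the case k =
    3.\<close>
  proof -
    have "(m - 2) * (m + 1) \<ge> 0" using m by simp
    moreover have "(m - 2) * (m + 1) = m * m - m - 2" by (simp add: algebra_simps)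
    ultimately show ?thesis unfolding kap_def power2_eq_square add_divide_distrib by linarith
  qed
  define C where "C = (kap - 1) / x + kap - (m + 1) + m\<^sup>2 * (1 + x) / 4"
  have "(x * z)\<^sup>2 \<le> (2 * x + 1) / m * (C * z\<^sup>2)"
  proof -
    have "m * x\<^sup>2 \<le> m * m / 2 * x\<^sup>2" using mm by (intro mult_right_mono) auto
    also have "\<dots> = 2 * x * (m\<^sup>2 * x / 4)" by (simp add: power2_eq_square)
    also have "\<dots> \<le> (2 * x + 1) * C"
    proof (intro mult_mono)
      have "C = (kap - 1) / x + (kap - (m + 1) + m\<^sup>2 / 4) + m\<^sup>2 * x / 4"
        by (simp add: C_def algebra_simps add_divide_distrib)
      then show "m\<^sup>2 * x / 4 \<le> C" using k1 k2 x by simp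
    qed (use x in auto)
    finally have "x\<^sup>2 \<le> (2 * x + 1) / m * C" using m by (simp add: field_simps)
    from mult_right_mono[OF this, of "z\<^sup>2"] show ?thesis by (simp add: power_mult_distrib mult.assoc)
  qed
  then have "0 \<le> (2 * x + 1) / m * t\<^sup>2 + 2 * (x * z) * t + C * z\<^sup>2"
    using m x by (intro quadratic_form_nonneg) auto
  moreover have "(kap - 1) * (z\<^sup>2 / x) \<le> (kap - 1) * ff" using k1 ff by (intro mult_left_mono)
  ultimately show ?thesis by (simp add: C_def algebra_simps)
qed

text \<open>The rank-one corrections in \<open>D\<close> have \<open>y\<close> on one side, so the
  projection \<open>P\<close> orthogonal to \<open>y\<close> removes them: \<open>D\<close> and
  \<open>B\<close> have the same compression \<open>T\<close>, and \<open>p\<close> is |y|^2 ((tr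
  T)^2 - tr T^2). The trace inequality for \<open>T\<close> applies, and what remains is a quadratic
  form over w^3. The right side is \<open>div_second / (k - 2)\<close> in later notation.\<close>

lemma tangential_hardy_pointwise:
  fixes y f :: "real^'k" and B D :: "real^'k^'k" and w :: real
  defines "k \<equiv> real CARD('k)" and "r \<equiv> y \<bullet> y" and "z \<equiv> y \<bullet> f"
  defines "kap \<equiv> (k\<^sup>2 - 1) / 4"
  defines "p \<equiv> r * ((trace B)\<^sup>2 - trace (B ** B)) - 2 * trace B * (y \<bullet> (B *v y)) + 2 * ((y v* B) \<bullet> (B *v y))"
  assumes k3: "CARD('k) \<ge> 3" and w: "w > 0" "w\<^sup>2 = 1 + r"
    and D: "D = B + c1 *\<^sub>R outer f y + c2 *\<^sub>R outer y f"
  shows "w * (D \<bullet> D) + kap * (f \<bullet> f + z\<^sup>2) / w ^ 3 + (k - 1)\<^sup>2 * z\<^sup>2 / (4 * w) - f \<bullet> f / w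
     \<ge> r / w ^ 3 / (k - 2) * p - (r * (f \<bullet> f) + 2 * z * (r * trace B - y \<bullet> (B *v y)) - k * z\<^sup>2) / w ^ 3"
proof (cases "y = 0")
  \<comment> \<open>At the origin there is no radial direction to project along; the claim reduces
    to \<open>kap \<ge> 1\<close>.\<close>
  case True
  have k: "k \<ge> 3" using k3 by (simp add: k_def)
  then have "k * k \<ge> 3 * 3" by (intro mult_mono) auto
  then have "kap \<ge> 1" by (simp add: kap_def power2_eq_square)
  have "w = 1" using w True by (simp add: r_def power2_eq_1_iff)
  have "f \<bullet> f \<le> kap * (f \<bullet> f)" using \<open>kap \<ge> 1\<close> mult_right_mono[of 1 kap "f \<bullet> f"] by simp
  then have "f \<bullet> f \<le> D \<bullet> D + kap * (f \<bullet> f)" using inner_ge_zero[of D] by linarith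
  then show ?thesis using True \<open>w = 1\<close> by (simp add: r_def z_def)
next
  case False
  define m where "m = k - 1"
  have m: "m \<ge> 2" using k3 by (simp add: k_def m_def)
  have r: "r > 0" using False by (simp add: r_def)
  define e where "e = (1 / sqrt r) *\<^sub>R y"
  have sr: "sqrt r * sqrt r = r" using r by simp
  have ee: "e \<bullet> e = 1" using sr r by (simp add: e_def r_def[symmetric] field_simps)
  define P where "P = mat 1 - outer e e"
  have Pe: "P *v e = 0" "e v* P = 0"
    by (simp_all add: P_def matrix_vector_mult_diff_rdistrib vector_matrix_mult_diff_rdistrib outer_mult_vector vector_mult_outer ee)
  have PP: "P ** P = P"
  proof -
    have "P ** P = P ** mat 1 - P ** outer e e" by (simp add: P_def matrix_mul_diff_left)
    also have "P ** outer e e = 0" by (simp add: matrix_mul_outer Pe) (simp add: outer_def vec_eq_iff)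
    finally show ?thesis by simp
  qed
  have tP: "transpose P = P"
    by (simp add: P_def vec_eq_iff transpose_def outer_def mat_def mult.commute)
  have trP: "trace P = m"
    by (simp add: P_def trace_sub trace_I trace_outer ee m_def k_def)
  have ye: "y = sqrt r *\<^sub>R e" using r by (simp add: e_def)
  have Py: "P *v y = 0" "y v* P = 0"
    using Pe by (simp_all add: ye matrix_vector_mult_scaleR scaleR_vector_matrix_assoc)
  define b where "b = e v* B"
  define T where "T = P ** B ** P"
  have TD: "T = P ** D ** P"
  proof -
    have "P ** outer f y ** P = 0" "P ** outer y f ** P = 0"
      by (simp_all add: matrix_mul_outer outer_matrix_mul Py) (simp_all add: outer_def vec_eq_iff)
    then show ?thesis
      by (simp add: T_def D matrix_add_ldistrib matrix_mul_add_right matrix_mul_scaleR)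
  qed
  have PB: "P ** B = B - outer e b"
    by (simp add: P_def matrix_mul_diff_right outer_matrix_mul b_def)
  have trT: "trace T = trace B - e \<bullet> b"
  proof -
    have "trace T = trace (P ** (P ** B))" unfolding T_def by (rule trace_mul_sym)
    then show ?thesis by (simp add: matrix_mul_assoc PP) (simp add: PB trace_sub trace_outer)
  qed
  have trTT: "trace (T ** T) = trace (B ** B) - 2 * (b \<bullet> (B *v e)) + (e \<bullet> b)\<^sup>2"
  proof -
    have "trace (T ** T) = trace (P ** B ** (P ** P) ** B ** P)" by (simp add: T_def matrix_mul_assoc)
    also have "\<dots> = trace (P ** (P ** B ** P ** B))" by (simp add: PP) (rule trace_mul_sym)
    also have "\<dots> = trace ((P ** B) ** (P ** B))" by (simp add: PP matrix_mul_assoc)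
    also have "\<dots> = trace (B ** B) - 2 * (b \<bullet> (B *v e)) + (e \<bullet> b)\<^sup>2"
      using dot_lmul_matrix[of b B e]
      by (simp add: PB matrix_mul_diff_left matrix_mul_diff_right trace_sub trace_add matrix_mul_outer outer_matrix_mul
          trace_outer outer_mult_vector vector_mult_outer inner_commute power2_eq_square
          inner_diff_left inner_diff_right matrix_vector_mult_diff_rdistrib)
    finally show ?thesis .
  qed
  have s1: "y \<bullet> (B *v y) = r * (e \<bullet> b)"
    using sr by (simp add: ye matrix_vector_mult_scaleR b_def dot_lmul_matrix inner_commute[of e "e v* B"])
  have s2: "(y v* B) \<bullet> (B *v y) = r * (b \<bullet> (B *v e))"
    using sr by (simp add: ye matrix_vector_mult_scaleR b_def dot_lmul_matrix)
  have p: "p = r * ((trace T)\<^sup>2 - trace (T ** T))"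
    unfolding p_def s1 s2 trT trTT by (simp add: algebra_simps power2_eq_square)
  \<comment> \<open>This value turns the term g/(m - 1) of the trace inequality into the coefficient
    of \<open>p\<close>. Since w^4 = (1 + r)^2, it leaves w - g = (2 r + 1)/w^3.\<close>
  define g where "g = r\<^sup>2 / w ^ 3"
  have w3: "w ^ 3 > 0" using w by simp
  have w4: "w * w ^ 3 = (1 + r)\<^sup>2" using w(2) by (simp add: power2_eq_square power3_eq_cube algebra_simps)
  have wg: "w - g = (2 * r + 1) / w ^ 3"
    using w4 w3 by (simp add: g_def field_simps power2_eq_square)
  have g: "0 \<le> g" "g \<le> w"
  proof -
    show "0 \<le> g" using w3 by (simp add: g_def)
    have "0 \<le> w - g" using wg r w3 by simp
    then show "g \<le> w" by simp
  qed
  have main: "w * (D \<bullet> D) - g / (m - 1) * ((trace T)\<^sup>2 - trace (T ** T)) \<ge> (w - g) / m * (trace T)\<^sup>2"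
    by (rule projected_trace_inequality[OF PP tP trP TD m g])
  have gp: "g / (m - 1) * ((trace T)\<^sup>2 - trace (T ** T)) = r / w ^ 3 / (k - 2) * p"
    by (simp add: g_def p m_def power2_eq_square)
  have zz: "f \<bullet> f \<ge> z\<^sup>2 / r"
    using Cauchy_Schwarz_ineq[of y f] r by (simp add: z_def r_def field_simps)
  have kapm: "kap = (m\<^sup>2 + 2 * m) / 4" by (simp add: kap_def m_def power2_eq_square algebra_simps)
  have "0 \<le> (2 * r + 1) / m * (trace T)\<^sup>2 + 2 * z * r * trace T + (kap - 1) * (f \<bullet> f) + (kap - (m + 1) + m\<^sup>2 * (1 + r) / 4) * z\<^sup>2"
    using tangential_remainder_nonneg[OF m r zz, of "trace T"] by (simp add: kapm)
  then have "0 \<le> ((2 * r + 1) / m * (trace T)\<^sup>2 + 2 * z * r * trace T + (kap - 1) * (f \<bullet> f) + (kap - (m + 1) + m\<^sup>2 * (1 + r) / 4) * z\<^sup>2) / w ^ 3"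
    using w3 by simp
  also have "\<dots> = (w - g) / m * (trace T)\<^sup>2 + kap * (f \<bullet> f + z\<^sup>2) / w ^ 3 + (k - 1)\<^sup>2 * z\<^sup>2 / (4 * w) - f \<bullet> f / w
     + (r * (f \<bullet> f) + 2 * z * (r * trace B - y \<bullet> (B *v y)) - k * z\<^sup>2) / w ^ 3"
  proof -
    \<comment> \<open>All terms are brought over the common denominator w^3 by means of w^2 = 1 +
      r.\<close>
    have a: "(k - 1)\<^sup>2 * z\<^sup>2 / (4 * w) = (m\<^sup>2 * (1 + r) / 4 * z\<^sup>2) / w ^ 3"
      using w by (simp add: m_def power3_eq_cube w(2)[symmetric] power2_eq_square)
    have b: "f \<bullet> f / w = ((1 + r) * (f \<bullet> f)) / w ^ 3"
      using w by (simp add: power3_eq_cube w(2)[symmetric] power2_eq_square)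
    have c: "r * trace B - y \<bullet> (B *v y) = r * trace T" by (simp add: s1 trT right_diff_distrib)
    define q where "q = (2 * r + 1) / m * (trace T)\<^sup>2"
    define u where "u = m\<^sup>2 * (1 + r) / 4 * z\<^sup>2"
    have d: "(w - g) / m * (trace T)\<^sup>2 = q / w ^ 3" by (simp add: wg q_def)
    have e: "(kap - (m + 1) + m\<^sup>2 * (1 + r) / 4) * z\<^sup>2 = (kap - k) * z\<^sup>2 + u"
      by (simp add: u_def m_def distrib_right)
    define v where "v = w ^ 3"
    have "v \<noteq> 0" using w3 by (simp add: v_def)
    then show ?thesis unfolding a b c d e q_def[symmetric] u_def[symmetric] v_def[symmetric]
      by (simp add: field_simps)
  qed
  finally show ?thesis using main gp by simp
qed

section \<open>Null Lagrangians\<close>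

lemma has_dir_deriv_eq_rhs:
  "has_dir_deriv g a v \<Longrightarrow> (\<And>x. a x = b x) \<Longrightarrow> has_dir_deriv g b v"
  by (simp add: has_dir_deriv_def)

lemma has_dir_deriv_const: "has_dir_deriv (\<lambda>_. c) (\<lambda>_. 0) v"
  by (simp add: has_dir_deriv_def)

lemma has_dir_deriv_add:
  "has_dir_deriv g a v \<Longrightarrow> has_dir_deriv h b v \<Longrightarrow> has_dir_deriv (\<lambda>x. g x + h x) (\<lambda>x. a x + b x) v"
  unfolding has_dir_deriv_def by (auto intro: DERIV_add)

lemma has_dir_deriv_diff:
  "has_dir_deriv g a v \<Longrightarrow> has_dir_deriv h b v \<Longrightarrow> has_dir_deriv (\<lambda>x. g x - h x) (\<lambda>x. a x - b x) v"
  unfolding has_dir_deriv_def by (auto intro: DERIV_diff)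

lemma has_dir_deriv_mult:
  assumes "has_dir_deriv g a v" "has_dir_deriv h b v"
  shows "has_dir_deriv (\<lambda>x. g x * h x) (\<lambda>x. a x * h x + g x * b x) v"
  unfolding has_dir_deriv_def
proof
  fix x
  have "((\<lambda>t. g (x + t *\<^sub>R v)) has_real_derivative a x) (at 0)"
    "((\<lambda>t. h (x + t *\<^sub>R v)) has_real_derivative b x) (at 0)"
    using assms by (auto simp: has_dir_deriv_def)
  from DERIV_mult[OF this]
  show "((\<lambda>t. g (x + t *\<^sub>R v) * h (x + t *\<^sub>R v)) has_real_derivative a x * h x + g x * b x) (at 0)"
    by (simp add: mult.commute add.commute)
qed

lemma has_dir_deriv_sum:
  "(\<And>i. i \<in> I \<Longrightarrow> has_dir_deriv (g i) (a i) v) \<Longrightarrow> has_dir_deriv (\<lambda>x. \<Sum>i\<in>I. g i x) (\<lambda>x. \<Sum>i\<in>I. a i x) v"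
  unfolding has_dir_deriv_def by (auto intro: DERIV_sum)

lemma has_dir_deriv_chain:
  assumes "\<And>x. (\<phi> has_real_derivative \<phi>' (g x)) (at (g x))" "has_dir_deriv g a v"
  shows "has_dir_deriv (\<lambda>x. \<phi> (g x)) (\<lambda>x. \<phi>' (g x) * a x) v"
  unfolding has_dir_deriv_def
proof
  fix x
  have "((\<lambda>t. g (x + t *\<^sub>R v)) has_real_derivative a x) (at 0)"
    using assms by (auto simp: has_dir_deriv_def)
  moreover have "(\<phi> has_real_derivative \<phi>' (g x)) (at (g (x + 0 *\<^sub>R v)))" using assms(1) by simp
  ultimately show "((\<lambda>t. \<phi> (g (x + t *\<^sub>R v))) has_real_derivative \<phi>' (g x) * a x) (at 0)"
    by (intro DERIV_chain2[where f = \<phi> and g = "\<lambda>t. g (x + t *\<^sub>R v)"])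
qed

lemmas has_dir_deriv_intros = has_dir_deriv_const has_dir_deriv_add has_dir_deriv_diff has_dir_deriv_mult has_dir_deriv_sum

text \<open>Integrability is demanded explicitly because the integral of a non-integrable function
  is 0 by convention.\<close>

definition null_integral :: "('a::euclidean_space \<Rightarrow> real) \<Rightarrow> bool" where
  "null_integral g \<longleftrightarrow> integrable lborel g \<and> integral\<^sup>L lborel g = 0"

lemma null_integral_add: "null_integral g \<Longrightarrow> null_integral h \<Longrightarrow> null_integral (\<lambda>x. g x + h x)"
  by (simp add: null_integral_def)

lemma null_integral_diff: "null_integral g \<Longrightarrow> null_integral h \<Longrightarrow> null_integral (\<lambda>x. g x - h x)"
  by (simp add: null_integral_def)

lemma null_integral_mult: "null_integral g \<Longrightarrow> null_integral (\<lambda>x. c * g x)"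
  by (simp add: null_integral_def)

lemma null_integral_sum: "(\<And>i. i \<in> I \<Longrightarrow> null_integral (g i)) \<Longrightarrow> null_integral (\<lambda>x. \<Sum>i\<in>I. g i x)"
  by (simp add: null_integral_def)

text \<open>This is the divergence in \<open>null_div_tangential\<close> at one point, with
  \<open>s\<close> the scalar factor and \<open>d * y i\<close> its derivatives. The terms with
  \<open>d\<close> cancel since the field is orthogonal to \<open>y\<close>; the second derivatives
  cancel by the symmetry of \<open>H\<close>.\<close>

lemma tangential_divergence_algebra:
  fixes y f :: "'k::finite \<Rightarrow> real" and B :: "'k \<Rightarrow> 'k \<Rightarrow> real" and H :: "'k \<Rightarrow> 'k \<Rightarrow> 'k \<Rightarrow> real"
  assumes H: "\<And>l i j. H l i j = H i l j"
  defines "b \<equiv> \<lambda>i. \<Sum>j\<in>UNIV. B i j * y j" and "c \<equiv> \<lambda>i. \<Sum>j\<in>UNIV. y j * B j i"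
    and "e \<equiv> \<lambda>i. \<Sum>j\<in>UNIV. f j * B j i"
  defines "r \<equiv> \<Sum>i\<in>UNIV. y i * y i" and "z \<equiv> \<Sum>i\<in>UNIV. y i * f i" and "tr \<equiv> \<Sum>i\<in>UNIV. B i i"
    and "q \<equiv> \<Sum>i\<in>UNIV. y i * b i" and "p \<equiv> \<Sum>i\<in>UNIV. f i * b i"
  defines "h1 \<equiv> \<lambda>i. \<Sum>j\<in>UNIV. H i j j" and "h2 \<equiv> \<lambda>i. \<Sum>j\<in>UNIV. f j * H i j i"
    and "h3 \<equiv> \<lambda>i. \<Sum>j\<in>UNIV. y j * (\<Sum>l\<in>UNIV. H i j l * y l)"
    and "h4 \<equiv> \<lambda>i. \<Sum>j\<in>UNIV. f j * (\<Sum>l\<in>UNIV. H i j l * y l)"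
    and "h5 \<equiv> \<lambda>i. \<Sum>j\<in>UNIV. y j * H i j i"
  shows "(\<Sum>i\<in>UNIV. d * (r * tr * (y i * f i) - r * (y i * e i) - z * tr * (y i * y i) - q * (y i * f i)
            + p * (y i * y i) + z * (y i * c i))
        + s * (2 * tr * (y i * f i) - 2 * (y i * e i) + r * tr * B i i + r * (f i * h1 i)
            - r * (\<Sum>j\<in>UNIV. B i j * B j i) - r * h2 i - z * tr - tr * (y i * f i) - tr * (y i * b i)
            - z * (y i * h1 i) - q * B i i - f i * b i - f i * c i - f i * h3 i + p
            + y i * (\<Sum>j\<in>UNIV. B i j * b j) + y i * e i + y i * h4 i + f i * c i + b i * c i + z * B i i + z * h5 i))
      = s * (r * (tr\<^sup>2 - (\<Sum>i\<in>UNIV. \<Sum>j\<in>UNIV. B i j * B j i)) - 2 * tr * q + 2 * (\<Sum>i\<in>UNIV. c i * b i))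
        - (real CARD('k) - 2) * s * (z * tr - p)"
proof -
  have s1: "(\<Sum>i\<in>UNIV. y i * e i) = p"
    unfolding e_def p_def b_def sum_distrib_left
    by (subst sum.swap) (simp add: mult_ac)
  have s2: "(\<Sum>i\<in>UNIV. y i * c i) = q"
    unfolding c_def q_def b_def sum_distrib_left
    by (subst sum.swap) (simp add: mult_ac)
  have s3: "(\<Sum>i\<in>UNIV. y i * (\<Sum>j\<in>UNIV. B i j * b j)) = (\<Sum>i\<in>UNIV. c i * b i)"
    unfolding c_def sum_distrib_left sum_distrib_right
    by (subst sum.swap) (simp add: mult_ac)
  \<comment> \<open>The three identities pair off the second-derivative terms by exchanging the two
    differentiation indices of \<open>H\<close>.\<close>
  have t1: "(\<Sum>i\<in>UNIV. f i * h1 i) = (\<Sum>i\<in>UNIV. h2 i)"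
    unfolding h1_def h2_def sum_distrib_left
    by (subst sum.swap) (subst H, simp)
  have t2: "(\<Sum>i\<in>UNIV. y i * h1 i) = (\<Sum>i\<in>UNIV. h5 i)"
    unfolding h1_def h5_def sum_distrib_left
    by (subst sum.swap) (subst H, simp)
  have t3: "(\<Sum>i\<in>UNIV. f i * h3 i) = (\<Sum>i\<in>UNIV. y i * h4 i)"
  proof -
    have "(\<Sum>i\<in>UNIV. f i * h3 i) = (\<Sum>i\<in>UNIV. \<Sum>j\<in>UNIV. f i * y j * (\<Sum>l\<in>UNIV. H i j l * y l))"
      by (simp add: h3_def sum_distrib_left mult.assoc)
    also have "\<dots> = (\<Sum>j\<in>UNIV. \<Sum>i\<in>UNIV. f i * y j * (\<Sum>l\<in>UNIV. H j i l * y l))"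
      by (subst sum.swap) (subst H, simp)
    also have "\<dots> = (\<Sum>i\<in>UNIV. y i * h4 i)"
      by (simp add: h4_def sum_distrib_left mult_ac)
    finally show ?thesis .
  qed
  have u: "(\<Sum>i\<in>UNIV. b i * c i) = (\<Sum>i\<in>UNIV. c i * b i)" by (simp add: mult.commute)
  show ?thesis
    unfolding sum.distrib sum_subtractf sum_distrib_left[symmetric] s1 s2 s3 t1 t2 t3 u
      r_def[symmetric] z_def[symmetric] tr_def[symmetric] q_def[symmetric] p_def[symmetric]
    by (simp add: algebra_simps power2_eq_square)
qed

text \<open>
  Here \<open>v i\<close> is the direction \<open>\<partial>/\<partial>y\<^sub>i\<close>, \<open>f\<close> are the components of the normal field, and
  \<open>B i j = \<partial>\<^sub>i f\<^sub>j\<close>, \<open>H l i j = \<partial>\<^sub>l \<partial>\<^sub>i f\<^sub>j\<close>.  The vertical component is \<open>- z = - y \<bullet> f\<close>.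
\<close>

locale section_data =
  fixes v :: "'k::finite \<Rightarrow> 'a::euclidean_space" and y f :: "'k \<Rightarrow> 'a \<Rightarrow> real"
    and B :: "'k \<Rightarrow> 'k \<Rightarrow> 'a \<Rightarrow> real" and H :: "'k \<Rightarrow> 'k \<Rightarrow> 'k \<Rightarrow> 'a \<Rightarrow> real"
  assumes dy: "has_dir_deriv (y j) (\<lambda>_. of_bool (i = j)) (v i)"
    and df: "has_dir_deriv (f j) (B i j) (v i)"
    and dB: "has_dir_deriv (B i j) (H l i j) (v l)"
    and H_sym: "H l i j x = H i l j x"
    and cy: "continuous_on UNIV (y j)" and cf: "continuous_on UNIV (f j)"
    and cB: "continuous_on UNIV (B i j)" and cH: "continuous_on UNIV (H l i j)"
    and supp: "bounded {x. \<exists>j. f j x \<noteq> 0}"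
begin

definition "b i x = (\<Sum>j\<in>UNIV. B i j x * y j x)"
definition "c i x = (\<Sum>j\<in>UNIV. y j x * B j i x)"
definition "e i x = (\<Sum>j\<in>UNIV. f j x * B j i x)"
definition "r x = (\<Sum>i\<in>UNIV. y i x * y i x)"
definition "z x = (\<Sum>i\<in>UNIV. y i x * f i x)"
definition "tr x = (\<Sum>i\<in>UNIV. B i i x)"
definition "q x = (\<Sum>i\<in>UNIV. y i x * b i x)"
definition "p x = (\<Sum>i\<in>UNIV. f i x * b i x)"
definition "ff x = (\<Sum>i\<in>UNIV. f i x * f i x)"
text \<open>The relation \<partial>_i u = - y_i u^3 makes the derivatives of all fields below
  polynomial in \<open>u\<close>; \<open>w\<close> is the volume density itself.\<close>

definition "u x = 1 / sqrt (1 + r x)"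
definition "w x = sqrt (1 + r x)"
text \<open>\<open>h1\<close> to \<open>h5\<close> are the second-order parts of the derivatives of
  \<open>tr\<close>, \<open>e\<close>, \<open>q\<close>, \<open>p\<close> and \<open>c\<close>, in
  this order.\<close>

definition "h1 i x = (\<Sum>j\<in>UNIV. H i j j x)"
definition "h2 i x = (\<Sum>j\<in>UNIV. f j x * H i j i x)"
definition "h3 i x = (\<Sum>j\<in>UNIV. y j x * (\<Sum>l\<in>UNIV. H i j l x * y l x))"
definition "h4 i x = (\<Sum>j\<in>UNIV. f j x * (\<Sum>l\<in>UNIV. H i j l x * y l x))"
definition "h5 i x = (\<Sum>j\<in>UNIV. y j x * H i j i x)"
definition "bb i x = (\<Sum>j\<in>UNIV. B i j x * B j i x)"
definition "Bb i x = (\<Sum>j\<in>UNIV. B i j x * b j x)"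
text \<open>The derivative \<open>\<partial>\<^sub>i (y\<^sub>i |V|\<^sup>2 / W)\<close>.\<close>

definition "div_first i x = u x * (1 - (y i x * u x)\<^sup>2) * (ff x + (z x)\<^sup>2)
   + 2 * (y i x * u x) * ((\<Sum>j\<in>UNIV. B i j x * f j x) + z x * (b i x + f i x))"

lemma r_nonneg: "r x \<ge> 0"
  by (simp add: r_def sum_nonneg)

lemma u_pos: "u x > 0" and u_sq: "(u x)\<^sup>2 * (1 + r x) = 1"
  using r_nonneg[of x] by (simp_all add: u_def power_divide)

lemma cont: "continuous_on UNIV (b i)" "continuous_on UNIV (c i)" "continuous_on UNIV (e i)"
  "continuous_on UNIV r" "continuous_on UNIV z" "continuous_on UNIV tr" "continuous_on UNIV q"
  "continuous_on UNIV p" "continuous_on UNIV ff" "continuous_on UNIV u"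
proof -
  note [continuous_intros] = cy cf cB cH
  show b: "continuous_on UNIV (b i)" for i unfolding b_def[abs_def] by (intro continuous_intros)
  note [continuous_intros] = b
  show "continuous_on UNIV (c i)" unfolding c_def[abs_def] by (intro continuous_intros)
  show "continuous_on UNIV (e i)" unfolding e_def[abs_def] by (intro continuous_intros)
  show r: "continuous_on UNIV r" unfolding r_def[abs_def] by (intro continuous_intros)
  show "continuous_on UNIV z" unfolding z_def[abs_def] by (intro continuous_intros)
  show "continuous_on UNIV tr" unfolding tr_def[abs_def] by (intro continuous_intros)
  show "continuous_on UNIV q" unfolding q_def[abs_def] by (intro continuous_intros)
  show "continuous_on UNIV p" unfolding p_def[abs_def] by (intro continuous_intros)
  show "continuous_on UNIV ff" unfolding ff_def[abs_def] by (intro continuous_intros)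
  show "continuous_on UNIV u" unfolding u_def[abs_def] using r_nonneg r
    by (intro continuous_intros) (auto simp: add_nonneg_eq_0_iff)
qed

lemmas conts = cont cy cf cB cH

lemma dsum_delta:
  fixes i :: 'k
  shows "(\<Sum>j\<in>UNIV. of_bool (i = j) * g j) = g i" "(\<Sum>j\<in>UNIV. g j * of_bool (i = j)) = (g i :: real)"
  by (simp_all add: of_bool_def if_distrib if_distribR cong: if_cong)

lemma deriv_b: "has_dir_deriv (b j) (\<lambda>x. B j i x + (\<Sum>l\<in>UNIV. H i j l x * y l x)) (v i)"
  unfolding b_def[abs_def]
  by (rule has_dir_deriv_eq_rhs, (rule has_dir_deriv_intros dB dy)+) (simp add: sum.distrib dsum_delta add.commute)

lemma deriv_c: "has_dir_deriv (c i) (\<lambda>x. B i i x + h5 i x) (v i)"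
  unfolding c_def[abs_def] h5_def
  by (rule has_dir_deriv_eq_rhs, (rule has_dir_deriv_intros dB dy)+) (simp add: sum.distrib dsum_delta)

lemma deriv_e: "has_dir_deriv (e i) (\<lambda>x. bb i x + h2 i x) (v i)"
  unfolding e_def[abs_def] bb_def h2_def
  by (rule has_dir_deriv_eq_rhs, (rule has_dir_deriv_intros dB df)+) (simp add: sum.distrib)

lemma deriv_r: "has_dir_deriv r (\<lambda>x. 2 * y i x) (v i)"
  unfolding r_def[abs_def]
  by (rule has_dir_deriv_eq_rhs, (rule has_dir_deriv_intros dy)+) (simp add: mult.commute sum_distrib_left[symmetric] dsum_delta)

lemma deriv_z: "has_dir_deriv z (\<lambda>x. f i x + b i x) (v i)"
  unfolding z_def[abs_def]
  by (rule has_dir_deriv_eq_rhs, (rule has_dir_deriv_intros dy df)+) (simp add: sum.distrib dsum_delta b_def mult.commute)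

lemma deriv_tr: "has_dir_deriv tr (h1 i) (v i)"
  unfolding tr_def[abs_def] h1_def[abs_def] by (rule has_dir_deriv_intros dB)+

lemma deriv_q: "has_dir_deriv q (\<lambda>x. b i x + c i x + h3 i x) (v i)"
  unfolding q_def[abs_def] h3_def
  by (rule has_dir_deriv_eq_rhs, (rule has_dir_deriv_intros dy deriv_b)+)
     (simp add: sum.distrib dsum_delta c_def distrib_left)

lemma deriv_p: "has_dir_deriv p (\<lambda>x. Bb i x + e i x + h4 i x) (v i)"
  unfolding p_def[abs_def] Bb_def h4_def
  by (rule has_dir_deriv_eq_rhs, (rule has_dir_deriv_intros df deriv_b)+)
     (simp add: sum.distrib e_def distrib_left)

lemma deriv_ff: "has_dir_deriv ff (\<lambda>x. 2 * (\<Sum>j\<in>UNIV. B i j x * f j x)) (v i)"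
  unfolding ff_def[abs_def]
  by (rule has_dir_deriv_eq_rhs, (rule has_dir_deriv_intros df)+) (simp add: sum.distrib sum_distrib_left[symmetric] mult.commute)

lemma deriv_u: "has_dir_deriv u (\<lambda>x. - y i x * (u x) ^ 3) (v i)"
proof -
  have "((\<lambda>t. 1 / sqrt (1 + t)) has_real_derivative (- (1 / 2) * (1 / sqrt (1 + t)) ^ 3)) (at t)" if "t \<ge> 0" for t :: real
    using that by (auto intro!: derivative_eq_intros simp: field_simps power3_eq_cube)
  then have "has_dir_deriv (\<lambda>x. 1 / sqrt (1 + r x)) (\<lambda>x. (- (1 / 2) * (1 / sqrt (1 + r x)) ^ 3) * (2 * y i x)) (v i)"
    using r_nonneg by (intro has_dir_deriv_chain[OF _ deriv_r]) blast
  then show ?thesis unfolding u_def[abs_def]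
    by (rule has_dir_deriv_eq_rhs) simp
qed

section \<open>Divergences built from the normal field\<close>

lemma null_divergence:
  assumes "\<And>i. has_dir_deriv (J i) (D i) (v i)" "\<And>i. continuous_on UNIV (J i)" "\<And>i. continuous_on UNIV (D i)"
    and "\<And>i x. (\<And>j. f j x = 0) \<Longrightarrow> J i x = 0"
  shows "null_integral (D i)" "null_integral (\<lambda>x. \<Sum>i\<in>UNIV. D i x)"
proof -
  show *: "null_integral (D i)" for i
  proof -
    have "bounded {x. J i x \<noteq> 0}"
      by (rule bounded_subset[OF supp]) (use assms(4) in auto)
    from integral_dir_deriv_eq_0[OF assms(1-3) this] show ?thesis by (simp add: null_integral_def)
  qed
  show "null_integral (\<lambda>x. \<Sum>i\<in>UNIV. D i x)" by (intro null_integral_sum *)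
qed

lemma f_0: assumes "\<And>j. f j x = 0" shows "ff x = 0" "z x = 0" "p x = 0" "e i x = 0"
  using assms by (simp_all add: ff_def z_def p_def e_def)

lemma null_div_first: "null_integral (div_first i)"
proof (rule null_divergence(1))
  show "has_dir_deriv (\<lambda>x. y i x * u x * (ff x + z x * z x)) (div_first i) (v i)" for i
    by (rule has_dir_deriv_eq_rhs, (rule has_dir_deriv_intros dy deriv_u deriv_ff deriv_z)+)
       (simp add: div_first_def power2_eq_square power3_eq_cube algebra_simps)
  show "continuous_on UNIV (\<lambda>x. y i x * u x * (ff x + z x * z x))" for i
    by (intro continuous_intros conts)
  show "continuous_on UNIV (div_first i)" for i
    unfolding div_first_def[abs_def] by (intro continuous_intros conts)
qed (simp add: f_0)

text \<open>Divergence of the field r u^3 z f. It serves to eliminate \<open>p\<close> from the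
  tangential divergence.\<close>

lemma null_div_zf: "null_integral (\<lambda>x. (2 * u x ^ 3 - 3 * r x * u x ^ 5) * (z x)\<^sup>2 + r x * u x ^ 3 * (ff x + p x + z x * tr x))"
proof -
  let ?D = "\<lambda>i x. (2 * u x ^ 3 - 3 * r x * u x ^ 5) * z x * (y i x * f i x) + r x * u x ^ 3 * (f i x * f i x + f i x * b i x + z x * B i i x)"
  have "null_integral (\<lambda>x. \<Sum>i\<in>UNIV. ?D i x)"
  proof (rule null_divergence(2))
    show "has_dir_deriv (\<lambda>x. r x * (u x * u x * u x) * z x * f i x) (?D i) (v i)" for i
      by (rule has_dir_deriv_eq_rhs, (rule has_dir_deriv_intros dy df deriv_u deriv_r deriv_z)+)
         (simp add: power3_eq_cube eval_nat_numeral algebra_simps)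
    show "continuous_on UNIV (\<lambda>x. r x * (u x * u x * u x) * z x * f i x)" "continuous_on UNIV (?D i)" for i
      by (intro continuous_intros conts)+
  qed (simp add: f_0)
  moreover have "(\<Sum>i\<in>UNIV. ?D i x) = (2 * u x ^ 3 - 3 * r x * u x ^ 5) * (z x)\<^sup>2 + r x * u x ^ 3 * (ff x + p x + z x * tr x)" for x
    unfolding sum.distrib sum_distrib_left[symmetric] z_def[symmetric] ff_def[symmetric] p_def[symmetric] tr_def[symmetric]
    by (simp add: power2_eq_square algebra_simps)
  ultimately show ?thesis by simp
qed

text \<open>Divergence of the field u^3 z^2 y. It cancels the u^5 terms of
  \<open>null_div_zf\<close>.\<close>

lemma null_div_yzz: "null_integral (\<lambda>x. (real CARD('k) * u x ^ 3 - 3 * r x * u x ^ 5) * (z x)\<^sup>2 + 2 * u x ^ 3 * z x * (z x + q x))"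
proof -
  let ?D = "\<lambda>i x. u x ^ 3 * (z x)\<^sup>2 - 3 * u x ^ 5 * (z x)\<^sup>2 * (y i x * y i x) + 2 * u x ^ 3 * z x * (y i x * f i x + y i x * b i x)"
  have "null_integral (\<lambda>x. \<Sum>i\<in>UNIV. ?D i x)"
  proof (rule null_divergence(2))
    show "has_dir_deriv (\<lambda>x. (u x * u x * u x) * (z x * z x) * y i x) (?D i) (v i)" for i
      by (rule has_dir_deriv_eq_rhs, (rule has_dir_deriv_intros dy df deriv_u deriv_r deriv_z)+)
         (simp add: power2_eq_square power3_eq_cube eval_nat_numeral algebra_simps)
    show "continuous_on UNIV (\<lambda>x. (u x * u x * u x) * (z x * z x) * y i x)" "continuous_on UNIV (?D i)" for i
      by (intro continuous_intros conts)+
  qed (simp add: f_0)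
  moreover have "(\<Sum>i\<in>UNIV. ?D i x) = (real CARD('k) * u x ^ 3 - 3 * r x * u x ^ 5) * (z x)\<^sup>2 + 2 * u x ^ 3 * z x * (z x + q x)" for x
    unfolding sum.distrib sum_subtractf sum_distrib_left[symmetric] z_def[symmetric] q_def[symmetric] r_def[symmetric]
    by (simp add: algebra_simps)
  ultimately show ?thesis by simp
qed

text \<open>
  With \<open>T = P B P\<close>, where \<open>P\<close> is the projection onto the orthogonal complement of \<open>y\<close>, this is
  \<open>|y|\<^sup>2 ((tr T)\<^sup>2 - tr T\<^sup>2)\<close>; the factor removes the singularity of \<open>P\<close> at the origin.
\<close>

definition "tangential_form x = r x * ((tr x)\<^sup>2 - (\<Sum>i\<in>UNIV. \<Sum>j\<in>UNIV. B i j x * B j i x)) - 2 * tr x * q x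
   + 2 * (\<Sum>i\<in>UNIV. c i x * b i x)"

text \<open>In flat space f tr B - f B has divergence (tr B)^2 - tr B^2. The field \<open>?J\<close>
  is its analogue for Pf and T = P B P with \<open>P\<close> the projection orthogonal to
  \<open>y\<close>, multiplied by r^2 u^3; the factor makes it polynomial in y and u.\<close>

lemma null_div_tangential:
  "null_integral (\<lambda>x. r x * u x ^ 3 * tangential_form x
     - (real CARD('k) - 2) * (r x * u x ^ 3) * (z x * tr x - p x))"
proof -
  let ?D = "\<lambda>i x. (2 * u x ^ 3 - 3 * r x * u x ^ 5) * (r x * tr x * (y i x * f i x) - r x * (y i x * e i x)
            - z x * tr x * (y i x * y i x) - q x * (y i x * f i x) + p x * (y i x * y i x) + z x * (y i x * c i x))
        + r x * u x ^ 3 * (2 * tr x * (y i x * f i x) - 2 * (y i x * e i x) + r x * tr x * B i i x + r x * (f i x * h1 i x)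
            - r x * bb i x - r x * h2 i x - z x * tr x - tr x * (y i x * f i x) - tr x * (y i x * b i x)
            - z x * (y i x * h1 i x) - q x * B i i x - f i x * b i x - f i x * c i x - f i x * h3 i x + p x
            + y i x * Bb i x + y i x * e i x + y i x * h4 i x + f i x * c i x + b i x * c i x + z x * B i i x + z x * h5 i x)"
  have "null_integral (\<lambda>x. \<Sum>i\<in>UNIV. ?D i x)"
  proof (rule null_divergence(2))
    let ?J = "\<lambda>i x. r x * (u x * u x * u x) * (r x * (f i x * tr x - e i x) - y i x * z x * tr x - f i x * q x
         + y i x * p x + z x * c i x)"
    show "has_dir_deriv (?J i) (?D i) (v i)" for i
      by (rule has_dir_deriv_eq_rhs,
          (rule has_dir_deriv_intros dy df deriv_u deriv_r deriv_z deriv_tr deriv_e deriv_q deriv_p deriv_c)+)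
         (simp add: power3_eq_cube eval_nat_numeral algebra_simps)
    show "continuous_on UNIV (?J i)" "continuous_on UNIV (?D i)" for i
      unfolding h1_def h2_def h3_def h4_def h5_def bb_def Bb_def
      by (intro continuous_intros conts)+
  qed (simp add: f_0)
  moreover have "(\<Sum>i\<in>UNIV. ?D i x) = r x * u x ^ 3 * tangential_form x
     - (real CARD('k) - 2) * (r x * u x ^ 3) * (z x * tr x - p x)" for x
    unfolding tangential_form_def
    using tangential_divergence_algebra[where H = "\<lambda>l i j. H l i j x" and y = "\<lambda>i. y i x" and f = "\<lambda>i. f i x"
        and B = "\<lambda>i j. B i j x" and s = "r x * u x ^ 3" and d = "2 * u x ^ 3 - 3 * r x * u x ^ 5"] H_sym
    unfolding b_def c_def e_def r_def z_def tr_def q_def p_def h1_def h2_def h3_def h4_def h5_def bb_def Bb_def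
    by blast
  ultimately show ?thesis by simp
qed

definition "div_second x = r x * u x ^ 3 * tangential_form x
   - (real CARD('k) - 2) * u x ^ 3 * (r x * ff x + 2 * z x * (r x * tr x - q x) - real CARD('k) * (z x)\<^sup>2)"

text \<open>In this combination of the three preceding divergences \<open>p\<close> and the u^5
  terms cancel, and the remaining first-order terms contain only r tr - q, that is r tr T.\<close>

lemma null_div_second: "null_integral div_second"
proof -
  let ?k = "real CARD('k)"
  have "null_integral (\<lambda>x. (r x * u x ^ 3 * tangential_form x - (?k - 2) * (r x * u x ^ 3) * (z x * tr x - p x))
     - (?k - 2) * ((2 * u x ^ 3 - 3 * r x * u x ^ 5) * (z x)\<^sup>2 + r x * u x ^ 3 * (ff x + p x + z x * tr x))
     + (?k - 2) * ((?k * u x ^ 3 - 3 * r x * u x ^ 5) * (z x)\<^sup>2 + 2 * u x ^ 3 * z x * (z x + q x)))"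
    by (intro null_integral_add null_integral_diff null_integral_mult null_div_tangential null_div_zf null_div_yzz)
  moreover have "(r x * u x ^ 3 * tangential_form x - (?k - 2) * (r x * u x ^ 3) * (z x * tr x - p x))
     - (?k - 2) * ((2 * u x ^ 3 - 3 * r x * u x ^ 5) * (z x)\<^sup>2 + r x * u x ^ 3 * (ff x + p x + z x * tr x))
     + (?k - 2) * ((?k * u x ^ 3 - 3 * r x * u x ^ 5) * (z x)\<^sup>2 + 2 * u x ^ 3 * z x * (z x + q x)) = div_second x" for x
    unfolding div_second_def by (simp add: algebra_simps power2_eq_square)
  ultimately show ?thesis by simp
qed

section \<open>Hardy inequalities for the normal gradient\<close>

text \<open>
  The square of the normal part of \<open>\<partial>\<^sub>i V\<close>: the tangent vector \<open>\<partial>F/\<partial>s\<close> has length \<open>W\<close>, and its inner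
  product with \<open>\<partial>\<^sub>i V\<close> is \<open>- f\<^sub>i\<close>.
\<close>

definition "grad_sq i x = (\<Sum>j\<in>UNIV. (B i j x)\<^sup>2) + (b i x + f i x)\<^sup>2 - (f i x * u x)\<^sup>2"

lemma w_pos: "w x > 0" and w_u: "w x * u x = 1" and w_sq: "(w x)\<^sup>2 = 1 + r x"
  using r_nonneg[of x] by (simp_all add: w_def u_def)

text \<open>Both sides are |\<nabla>_i V + s V|^2. In the frame of the vectors \<open>nu\<close> and
  the vertical direction, \<partial>_i V is (B_i, -(b_i + f_i)), and its normal part arises by
  adding f_i u^2 (y, 1), where (y, 1) represents \<partial>F/\<partial>s.\<close>

lemma grad_sq_shift:
  "grad_sq i x + 2 * s * ((\<Sum>j\<in>UNIV. B i j x * f j x) + z x * (b i x + f i x)) + s\<^sup>2 * (ff x + (z x)\<^sup>2)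
   = (\<Sum>j\<in>UNIV. (B i j x + f i x * (u x)\<^sup>2 * y j x + s * f j x)\<^sup>2)
     + (f i x * (u x)\<^sup>2 - (b i x + f i x) - s * z x)\<^sup>2"
proof -
  let ?t = "f i x * (u x)\<^sup>2"
  have "(\<Sum>j\<in>UNIV. (B i j x + ?t * y j x + s * f j x)\<^sup>2)
     = (\<Sum>j\<in>UNIV. (B i j x)\<^sup>2 + ?t\<^sup>2 * (y j x * y j x) + s\<^sup>2 * (f j x * f j x)
          + 2 * ?t * (B i j x * y j x) + 2 * s * (B i j x * f j x) + 2 * ?t * s * (y j x * f j x))"
    by (intro sum.cong refl) (simp add: power2_eq_square algebra_simps)
  also have "\<dots> = (\<Sum>j\<in>UNIV. (B i j x)\<^sup>2) + ?t\<^sup>2 * r x + s\<^sup>2 * ff x + 2 * ?t * b i x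
      + 2 * s * (\<Sum>j\<in>UNIV. B i j x * f j x) + 2 * ?t * s * z x"
    unfolding sum.distrib sum_distrib_left[symmetric] b_def r_def ff_def z_def by simp
  finally have *: "(\<Sum>j\<in>UNIV. (B i j x + ?t * y j x + s * f j x)\<^sup>2) = \<dots>" .
  have "?t\<^sup>2 * r x = f i x * f i x * (u x)\<^sup>2 * ((u x)\<^sup>2 * (1 + r x)) - ?t\<^sup>2"
    by (simp add: power2_eq_square algebra_simps)
  then have t: "?t\<^sup>2 * r x = f i x * f i x * (u x)\<^sup>2 - ?t\<^sup>2" by (simp add: u_sq)
  show ?thesis unfolding * t grad_sq_def by (simp add: power2_eq_square algebra_simps)
qed

text \<open>The shift is s y_i/W^2. Its cross term is the derivative part of
  \<open>s * div_first\<close>, and the rest of that divergence produces the potential. The vertical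
  square is discarded; the squares over \<open>j\<close> are kept for the isotropic
  estimate.\<close>

lemma grad_sq_lower:
  "w x * grad_sq i x \<ge> w x * (\<Sum>j\<in>UNIV. (B i j x + f i x * (u x)\<^sup>2 * y j x + s * (u x)\<^sup>2 * y i x * f j x)\<^sup>2)
     - s * div_first i x + (s - (s + s\<^sup>2) * (y i x * u x)\<^sup>2) * (u x * (ff x + (z x)\<^sup>2))"
proof -
  let ?c = "(\<Sum>j\<in>UNIV. B i j x * f j x) + z x * (b i x + f i x)"
  let ?S = "\<Sum>j\<in>UNIV. (B i j x + f i x * (u x)\<^sup>2 * y j x + s * (u x)\<^sup>2 * y i x * f j x)\<^sup>2"
  have "?S \<le> grad_sq i x + 2 * (s * (u x)\<^sup>2 * y i x) * ?c + (s * (u x)\<^sup>2 * y i x)\<^sup>2 * (ff x + (z x)\<^sup>2)"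
    unfolding grad_sq_shift by simp
  then have "w x * ?S \<le> w x * (grad_sq i x + 2 * (s * (u x)\<^sup>2 * y i x) * ?c + (s * (u x)\<^sup>2 * y i x)\<^sup>2 * (ff x + (z x)\<^sup>2))"
    using w_pos[of x] by (intro mult_left_mono) auto
  also have "\<dots> = w x * grad_sq i x + 2 * s * (w x * u x) * (y i x * u x) * ?c
      + s\<^sup>2 * (w x * u x) * (y i x * u x)\<^sup>2 * (u x * (ff x + (z x)\<^sup>2))"
    by (simp add: power2_eq_square algebra_simps)
  also have "\<dots> = w x * grad_sq i x + s * div_first i x - (s - (s + s\<^sup>2) * (y i x * u x)\<^sup>2) * (u x * (ff x + (z x)\<^sup>2))"
    unfolding w_u by (simp add: div_first_def algebra_simps)
  finally show ?thesis by simp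
qed

text \<open>Each direction has its own shift \<open>bt i\<close>, with a_i (bt_i + bt_i^2) bounded
  by the common \<open>\<tau>\<close>. The negative potentials then add up to at most
  \<open>\<tau>\<close> times |y|^2/W^2 \<le> 1, and the completed squares are dropped.\<close>

lemma anisotropic_hardy:
  assumes a: "\<And>i. a i \<ge> 0" and bt: "\<And>i. a i * (bt i + (bt i)\<^sup>2) \<le> \<tau>" and \<tau>: "\<tau> \<ge> 0"
  shows "w x * (\<Sum>i\<in>UNIV. a i * grad_sq i x) \<ge> - (\<Sum>i\<in>UNIV. a i * bt i * div_first i x)
     + ((\<Sum>i\<in>UNIV. a i * bt i) - \<tau>) * (u x * (ff x + (z x)\<^sup>2))"
proof -
  let ?E = "u x * (ff x + (z x)\<^sup>2)"
  have E: "?E \<ge> 0" using u_pos[of x] by (simp add: ff_def sum_nonneg)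
  have "a i * (w x * grad_sq i x) \<ge> - (a i * bt i * div_first i x) + (a i * bt i - \<tau> * (y i x * u x)\<^sup>2) * ?E" for i
  proof -
    have "w x * grad_sq i x \<ge> - bt i * div_first i x + (bt i - (bt i + (bt i)\<^sup>2) * (y i x * u x)\<^sup>2) * ?E"
      (is "_ \<ge> ?R")
    proof -
      have "0 \<le> w x * (\<Sum>j\<in>UNIV. (B i j x + f i x * (u x)\<^sup>2 * y j x + bt i * (u x)\<^sup>2 * y i x * f j x)\<^sup>2)"
        using w_pos[of x] by (simp add: sum_nonneg)
      then show ?thesis using grad_sq_lower[where x = x and i = i and s = "bt i"] by simp
    qed
    from mult_left_mono[OF this a[of i]]
    have "a i * (w x * grad_sq i x) \<ge> - (a i * bt i * div_first i x)
        + (a i * bt i - a i * (bt i + (bt i)\<^sup>2) * (y i x * u x)\<^sup>2) * ?E"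
      by (simp add: algebra_simps)
    moreover have "(a i * bt i - \<tau> * (y i x * u x)\<^sup>2) * ?E
        \<le> (a i * bt i - a i * (bt i + (bt i)\<^sup>2) * (y i x * u x)\<^sup>2) * ?E"
      using bt[of i] E by (intro mult_right_mono diff_left_mono) auto
    ultimately show ?thesis by linarith
  qed
  then have "(\<Sum>i\<in>UNIV. a i * (w x * grad_sq i x))
      \<ge> (\<Sum>i\<in>UNIV. - (a i * bt i * div_first i x) + (a i * bt i - \<tau> * (y i x * u x)\<^sup>2) * ?E)"
    by (intro sum_mono)
  also have "(\<Sum>i\<in>UNIV. a i * (w x * grad_sq i x)) = w x * (\<Sum>i\<in>UNIV. a i * grad_sq i x)"
    by (simp add: sum_distrib_left mult_ac)
  also have "(\<Sum>i\<in>UNIV. - (a i * bt i * div_first i x) + (a i * bt i - \<tau> * (y i x * u x)\<^sup>2) * ?E)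
     = - (\<Sum>i\<in>UNIV. a i * bt i * div_first i x) + ((\<Sum>i\<in>UNIV. a i * bt i) - \<tau> * (r x * (u x)\<^sup>2)) * ?E"
    unfolding sum.distrib sum_negf sum_distrib_right[symmetric] sum_subtractf
    by (simp add: r_def power_mult_distrib sum_distrib_left sum_distrib_right power2_eq_square mult_ac)
  finally have "w x * (\<Sum>i\<in>UNIV. a i * grad_sq i x)
    \<ge> - (\<Sum>i\<in>UNIV. a i * bt i * div_first i x) + ((\<Sum>i\<in>UNIV. a i * bt i) - \<tau> * (r x * (u x)\<^sup>2)) * ?E" .
  moreover have "((\<Sum>i\<in>UNIV. a i * bt i) - \<tau>) * ?E \<le> ((\<Sum>i\<in>UNIV. a i * bt i) - \<tau> * (r x * (u x)\<^sup>2)) * ?E"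
  proof (intro mult_right_mono diff_left_mono E)
    have "r x * (u x)\<^sup>2 \<le> 1" using u_sq[of x] zero_le_power2[of "u x"] unfolding distrib_left mult.commute[of "r x"] by linarith
    then show "\<tau> * (r x * (u x)\<^sup>2) \<le> \<tau>" using \<tau> by (simp add: mult_left_le)
  qed
  ultimately show ?thesis by linarith
qed

text \<open>With s = (k - 1)/2 one has s + s^2 = \<open>kap\<close> and k s - \<open>kap\<close> =
  s^2, the Hardy constant. The retained squares form |D|^2, which
  \<open>tangential_hardy_pointwise\<close> converts into a null Lagrangian and the additional
  \<open>u x * ff x\<close>.\<close>

lemma isotropic_hardy:
  assumes k3: "CARD('k) \<ge> 3"
  defines "k \<equiv> real CARD('k)"
  shows "w x * (\<Sum>i\<in>UNIV. grad_sq i x) \<ge> div_second x / (k - 2) - (k - 1) / 2 * (\<Sum>i\<in>UNIV. div_first i x)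
     + ((k - 1)\<^sup>2 + 4) / 4 * (u x * ff x)"
proof -
  have k: "k \<ge> 3" using k3 by (simp add: k_def)
  define s where "s = (k - 1) / 2"
  define kap where "kap = (k\<^sup>2 - 1) / 4"
  have skap: "s + s\<^sup>2 = kap" by (simp add: s_def kap_def power2_eq_square field_simps)
  let ?E = "u x * (ff x + (z x)\<^sup>2)"
  define Y where "Y = (\<chi> i. y i x)"
  define F where "F = (\<chi> i. f i x)"
  define M where "M = (\<chi> i j. B i j x)"
  \<comment> \<open>The entries of \<open>D\<close> are those squared in
    \<open>grad_sq_lower\<close>: \<open>outer F Y\<close> comes from the normal projection,
    \<open>outer Y F\<close> from the shift.\<close>
  define D where "D = M + (u x)\<^sup>2 *\<^sub>R outer F Y + (s * (u x)\<^sup>2) *\<^sub>R outer Y F"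
  have YY: "Y \<bullet> Y = r x" "Y \<bullet> F = z x" "F \<bullet> F = ff x"
    by (simp_all add: Y_def F_def inner_vec_def r_def z_def ff_def)
  have MY: "M *v Y = (\<chi> i. b i x)" "Y v* M = (\<chi> i. c i x)"
    by (simp_all add: vec_eq_iff M_def Y_def matrix_vector_mult_def vector_matrix_mult_def b_def c_def)
  have tM: "trace M = tr x" "trace (M ** M) = (\<Sum>i\<in>UNIV. \<Sum>j\<in>UNIV. B i j x * B j i x)"
    by (simp_all add: trace_def M_def tr_def matrix_matrix_mult_def)
  have q: "Y \<bullet> (M *v Y) = q x" by (simp add: MY) (simp add: Y_def inner_vec_def q_def)
  have tf: "Y \<bullet> Y * ((trace M)\<^sup>2 - trace (M ** M)) - 2 * trace M * (Y \<bullet> (M *v Y)) + 2 * ((Y v* M) \<bullet> (M *v Y)) = tangential_form x"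
    unfolding YY tM q by (simp add: MY tangential_form_def inner_vec_def)
  have DD: "D \<bullet> D = (\<Sum>i\<in>UNIV. \<Sum>j\<in>UNIV. (B i j x + f i x * (u x)\<^sup>2 * y j x + s * (u x)\<^sup>2 * y i x * f j x)\<^sup>2)"
    by (simp add: D_def inner_vec_def outer_def M_def F_def Y_def power2_eq_square algebra_simps)
  have "w x * (D \<bullet> D) + kap * (F \<bullet> F + (Y \<bullet> F)\<^sup>2) / (w x) ^ 3 + (k - 1)\<^sup>2 * (Y \<bullet> F)\<^sup>2 / (4 * w x) - F \<bullet> F / w x
     \<ge> (Y \<bullet> Y) / (w x) ^ 3 / (k - 2) * tangential_form x
       - ((Y \<bullet> Y) * (F \<bullet> F) + 2 * (Y \<bullet> F) * ((Y \<bullet> Y) * trace M - Y \<bullet> (M *v Y)) - k * (Y \<bullet> F)\<^sup>2) / (w x) ^ 3"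
    unfolding tf[symmetric] kap_def k_def
    by (rule tangential_hardy_pointwise[OF k3 w_pos _ D_def]) (simp add: YY w_sq)
  also have "Y \<bullet> Y = r x" by (rule YY)
  finally have "r x / (w x) ^ 3 / (k - 2) * tangential_form x
       - (r x * ff x + 2 * z x * (r x * tr x - q x) - k * (z x)\<^sup>2) / (w x) ^ 3
     \<le> w x * (D \<bullet> D) + kap * (ff x + (z x)\<^sup>2) / (w x) ^ 3 + (k - 1)\<^sup>2 * (z x)\<^sup>2 / (4 * w x) - ff x / w x"
    unfolding YY q tM .
  then have *: "r x * (1 / w x) ^ 3 / (k - 2) * tangential_form x
       - (1 / w x) ^ 3 * (r x * ff x + 2 * z x * (r x * tr x - q x) - k * (z x)\<^sup>2)
     \<le> w x * (D \<bullet> D) + kap * (1 / w x) ^ 3 * (ff x + (z x)\<^sup>2) + s\<^sup>2 * ((1 / w x) * (z x)\<^sup>2) - (1 / w x) * ff x"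
    by (simp add: s_def power_divide)
  have uw: "1 / w x = u x" by (simp add: u_def w_def)
  have "div_second x / (k - 2) = r x * u x ^ 3 / (k - 2) * tangential_form x
       - u x ^ 3 * (r x * ff x + 2 * z x * (r x * tr x - q x) - k * (z x)\<^sup>2)"
    using k by (simp add: div_second_def k_def[symmetric] diff_divide_distrib)
  then have 1: "div_second x / (k - 2) \<le> w x * (D \<bullet> D) + kap * (u x)\<^sup>2 * ?E + s\<^sup>2 * (u x * (z x)\<^sup>2) - u x * ff x"
    using * unfolding uw by (simp add: power2_eq_square power3_eq_cube mult_ac)
  have "(\<Sum>i\<in>UNIV. w x * grad_sq i x) \<ge> (\<Sum>i\<in>UNIV. w x * (\<Sum>j\<in>UNIV. (B i j x + f i x * (u x)\<^sup>2 * y j x + s * (u x)\<^sup>2 * y i x * f j x)\<^sup>2)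
     - s * div_first i x + (s - (s + s\<^sup>2) * (y i x * u x)\<^sup>2) * ?E)"
    by (intro sum_mono grad_sq_lower)
  also have "(\<Sum>i\<in>UNIV. w x * grad_sq i x) = w x * (\<Sum>i\<in>UNIV. grad_sq i x)" by (simp add: sum_distrib_left)
  also have "(\<Sum>i\<in>UNIV. w x * (\<Sum>j\<in>UNIV. (B i j x + f i x * (u x)\<^sup>2 * y j x + s * (u x)\<^sup>2 * y i x * f j x)\<^sup>2)
     - s * div_first i x + (s - (s + s\<^sup>2) * (y i x * u x)\<^sup>2) * ?E)
    = w x * (D \<bullet> D) - s * (\<Sum>i\<in>UNIV. div_first i x) + (k * s - kap * (r x * (u x)\<^sup>2)) * ?E"
    unfolding skap DD sum.distrib sum_subtractf sum_distrib_left[symmetric] sum_distrib_right[symmetric]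
    by (simp add: r_def power_mult_distrib sum_distrib_left sum_distrib_right k_def power2_eq_square mult_ac)
  also have "r x * (u x)\<^sup>2 = 1 - (u x)\<^sup>2" using u_sq[of x] by (simp add: algebra_simps)
  finally have 2: "w x * (\<Sum>i\<in>UNIV. grad_sq i x)
     \<ge> w x * (D \<bullet> D) - s * (\<Sum>i\<in>UNIV. div_first i x) + (k * s - kap * (1 - (u x)\<^sup>2)) * ?E" .
  have ks: "k * s - kap * (1 - (u x)\<^sup>2) = s\<^sup>2 + kap * (u x)\<^sup>2"
    unfolding skap[symmetric] by (simp add: s_def power2_eq_square field_simps)
  have s4: "((k - 1)\<^sup>2 + 4) / 4 = s\<^sup>2 + 1" by (simp add: s_def power2_eq_square field_simps)
  \<comment> \<open>The vertical part s^2 u z^2 of the Hardy term is spent on the tangential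
    inequality, so only \<open>ff\<close> survives.\<close>
  show ?thesis unfolding s_def[symmetric] s4 using 1 2 unfolding ks by (simp add: algebra_simps)
qed

text \<open>The weight of each direction is split into \<open>a i\<close>, treated by the
  anisotropic estimate, and the common part \<open>s\<close>, treated by the isotropic one.\<close>

lemma hardy_lower_bound:
  assumes k3: "CARD('k) \<ge> 3"
    and a: "\<And>i. a i \<ge> 0" and bt: "\<And>i. a i * (bt i + (bt i)\<^sup>2) \<le> \<tau>" and \<tau>: "\<tau> \<ge> 0" and s: "s \<ge> 0"
  obtains g where "null_integral g"
    "\<forall>x. w x * (\<Sum>i\<in>UNIV. (a i + s) * grad_sq i x) \<ge> g x + ((\<Sum>i\<in>UNIV. a i * bt i) - \<tau>) * (u x * (ff x + (z x)\<^sup>2))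
        + s * (((real CARD('k) - 1)\<^sup>2 + 4) / 4) * (u x * ff x)"
proof
  let ?k = "real CARD('k)"
  let ?g = "\<lambda>x. s * (1 / (?k - 2) * div_second x - (?k - 1) / 2 * (\<Sum>i\<in>UNIV. div_first i x)) - (\<Sum>i\<in>UNIV. a i * bt i * div_first i x)"
  show "null_integral ?g"
    by (intro null_integral_diff null_integral_mult null_integral_sum null_div_second null_div_first)
  show "\<forall>x. w x * (\<Sum>i\<in>UNIV. (a i + s) * grad_sq i x) \<ge> ?g x + ((\<Sum>i\<in>UNIV. a i * bt i) - \<tau>) * (u x * (ff x + (z x)\<^sup>2))
        + s * (((?k - 1)\<^sup>2 + 4) / 4) * (u x * ff x)"
  proof
    fix x
    have eq: "w x * (\<Sum>i\<in>UNIV. (a i + s) * grad_sq i x)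
        = w x * (\<Sum>i\<in>UNIV. a i * grad_sq i x) + s * (w x * (\<Sum>i\<in>UNIV. grad_sq i x))"
      by (simp add: distrib_right sum.distrib sum_distrib_left mult_ac distrib_left)
    show "w x * (\<Sum>i\<in>UNIV. (a i + s) * grad_sq i x) \<ge> ?g x + ((\<Sum>i\<in>UNIV. a i * bt i) - \<tau>) * (u x * (ff x + (z x)\<^sup>2))
          + s * (((?k - 1)\<^sup>2 + 4) / 4) * (u x * ff x)"
      unfolding eq
      using anisotropic_hardy[where x = x and a = a and bt = bt, OF a bt \<tau>] mult_left_mono[OF isotropic_hardy[OF k3, of x] s]
      by (simp add: algebra_simps)
  qed
qed

end

section \<open>Geometry of the helicoid\<close>

lemma sum_UNIV_option: "(\<Sum>c\<in>UNIV. g c) = g None + (\<Sum>j\<in>(UNIV :: 'k::finite set). g (Some j))"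
  by (simp add: UNIV_option_conv sum.reindex)

lemma prod_UNIV_option: "(\<Prod>c\<in>UNIV. g c) = g None * (\<Prod>j\<in>(UNIV :: 'k::finite set). g (Some j))"
  by (simp add: UNIV_option_conv prod.reindex)

section \<open>Orthogonal projection onto the normal space\<close>

lemma normal_part_eqI:
  assumes "F differentiable (at p)" "y \<in> orthogonal_comp (tangent_space F p)" "w - y \<in> tangent_space F p"
  shows "normal_part F p w = y"
  unfolding normal_part_def
proof (rule the_equality)
  have sub: "subspace (tangent_space F p)"
    unfolding tangent_space_def using linear_frechet_derivative[OF assms(1)]
    by (intro linear_subspace_image) auto
  fix y' assume y': "y' \<in> orthogonal_comp (tangent_space F p) \<and> w - y' \<in> tangent_space F p"
  have "(w - y) - (w - y') \<in> tangent_space F p" using subspace_diff[OF sub assms(3)] y' by blast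
  then have "y' - y \<in> tangent_space F p" by simp
  moreover have "y' - y \<in> orthogonal_comp (tangent_space F p)"
    using subspace_diff[OF subspace_orthogonal_comp] y' assms(2) by blast
  ultimately have "orthogonal (y' - y) (y' - y)" unfolding orthogonal_comp_def by blast
  then show "y' = y" by (simp add: orthogonal_def)
qed (use assms in auto)

lemma normal_part_mem:
  fixes F :: "real^'n \<Rightarrow> 'e::euclidean_space"
  assumes "F differentiable (at p)"
  shows "normal_part F p w \<in> orthogonal_comp (tangent_space F p)" "w - normal_part F p w \<in> tangent_space F p"
proof -
  have sub: "subspace (tangent_space F p)"
    unfolding tangent_space_def using linear_frechet_derivative[OF assms(1)]
    by (intro linear_subspace_image) auto
  obtain y z where yz: "y \<in> span (tangent_space F p)" "\<And>v. v \<in> span (tangent_space F p) \<Longrightarrow> orthogonal z v" "w = y + z"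
    using orthogonal_subspace_decomp_exists by metis
  have 1: "z \<in> orthogonal_comp (tangent_space F p)" "w - z \<in> tangent_space F p"
  proof -
    show "z \<in> orthogonal_comp (tangent_space F p)"
      using yz(2) span_base orthogonal_commute unfolding orthogonal_comp_def by blast
    have "w - z = y" using yz(3) by simp
    then show "w - z \<in> tangent_space F p" using yz(1) sub span_eq_iff by metis
  qed
  then have "normal_part F p w = z" by (rule normal_part_eqI[OF assms])
  with 1 show "normal_part F p w \<in> orthogonal_comp (tangent_space F p)" "w - normal_part F p w \<in> tangent_space F p"
    by auto
qed

lemma linear_normal_part:
  fixes F :: "real^'n \<Rightarrow> 'e::euclidean_space"
  assumes F: "F differentiable (at p)"
  shows "linear (normal_part F p)"
proof -
  have sub: "subspace (tangent_space F p)"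
    unfolding tangent_space_def using linear_frechet_derivative[OF F]
    by (intro linear_subspace_image) auto
  note m = normal_part_mem[OF F]
  show ?thesis
  proof (rule linearI; rule normal_part_eqI[OF F])
    fix a b
    show "normal_part F p a + normal_part F p b \<in> orthogonal_comp (tangent_space F p)"
      by (intro subspace_add subspace_orthogonal_comp m)
    have "(a - normal_part F p a) + (b - normal_part F p b) \<in> tangent_space F p"
      by (intro subspace_add sub m)
    then show "a + b - (normal_part F p a + normal_part F p b) \<in> tangent_space F p"
      by (simp add: algebra_simps)
  next
    fix r b
    show "r *\<^sub>R normal_part F p b \<in> orthogonal_comp (tangent_space F p)"
      by (intro subspace_scale subspace_orthogonal_comp m)
    have "r *\<^sub>R (b - normal_part F p b) \<in> tangent_space F p"
      by (intro subspace_scale sub m)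
    then show "r *\<^sub>R b - r *\<^sub>R normal_part F p b \<in> tangent_space F p"
      by (simp add: algebra_simps)
  qed
qed

lemma inner_normal_part:
  fixes F :: "real^'n \<Rightarrow> 'e::euclidean_space"
  assumes "F differentiable (at p)" "n \<in> orthogonal_comp (tangent_space F p)"
  shows "normal_part F p w \<bullet> n = w \<bullet> n"
proof -
  have "orthogonal (w - normal_part F p w) n"
    using normal_part_mem(2)[OF assms(1)] assms(2) unfolding orthogonal_comp_def by blast
  then show ?thesis by (simp add: orthogonal_def inner_diff_left)
qed

text \<open>For a diagonal Gram matrix \<open>\<gamma>\<close>, orthonormality of the rows of a square matrix gives
  orthonormality of its columns.\<close>

lemma orthonormal_frame_sum:
  fixes e :: "'n::finite \<Rightarrow> real^'n" and \<gamma> :: "'n \<Rightarrow> real" and l :: "real^'n \<Rightarrow> 'b::real_inner"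
  assumes \<gamma>: "\<And>c. \<gamma> c > 0"
    and e: "\<And>a b. (\<Sum>c\<in>UNIV. \<gamma> c * e a $ c * e b $ c) = (if a = b then 1 else 0)"
    and l: "linear l"
  shows "(\<Sum>a\<in>UNIV. (norm (l (e a)))\<^sup>2) = (\<Sum>c\<in>UNIV. (norm (l (axis c 1)))\<^sup>2 / \<gamma> c)"
proof -
  define M where "M = (\<chi> a c. sqrt (\<gamma> c) * e a $ c)"
  have sg: "sqrt (\<gamma> c) * sqrt (\<gamma> c) = \<gamma> c" for c using \<gamma>[of c] by simp
  have "M ** transpose M = mat 1"
    unfolding vec_eq_iff
  proof (intro allI)
    fix a b
    have "(M ** transpose M) $ a $ b = (\<Sum>c\<in>UNIV. (sqrt (\<gamma> c) * e a $ c) * (sqrt (\<gamma> c) * e b $ c))"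
      by (simp add: M_def matrix_matrix_mult_def transpose_def)
    also have "\<dots> = (\<Sum>c\<in>UNIV. (sqrt (\<gamma> c) * sqrt (\<gamma> c)) * e a $ c * e b $ c)"
      by (simp only: mult_ac)
    finally show "(M ** transpose M) $ a $ b = (mat 1 :: real^'n^'n) $ a $ b"
      unfolding sg by (simp add: e mat_def)
  qed
  then have "transpose M ** M = mat 1" by (simp add: matrix_left_right_inverse)
  then have "(transpose M ** M) $ c $ d = (if c = d then 1 else 0)" for c d by (simp add: mat_def)
  then have M: "sqrt (\<gamma> c) * sqrt (\<gamma> d) * (\<Sum>a\<in>UNIV. e a $ c * e a $ d) = (if c = d then 1 else 0)" for c d
    by (simp add: M_def matrix_matrix_mult_def transpose_def sum_distrib_left mult_ac)
  \<comment> \<open>The frame vectors, summed over the frame index, reproduce the inverse of the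
    diagonal Gram matrix.\<close>
  have col: "(\<Sum>a\<in>UNIV. e a $ c * e a $ d) = (if c = d then 1 / \<gamma> c else 0)" for c d
  proof (cases "c = d")
    case True
    have "\<gamma> c * (\<Sum>a\<in>UNIV. e a $ c * e a $ c) = 1" using M[of c c] unfolding sg by simp
    then show ?thesis using True \<gamma>[of c] by (simp add: field_simps)
  next
    case False
    then show ?thesis using M[of c d] \<gamma>[of c] \<gamma>[of d] by simp
  qed
  have le: "l (e a) = (\<Sum>c\<in>UNIV. e a $ c *\<^sub>R l (axis c 1))" for a
  proof -
    have "e a = (\<Sum>c\<in>UNIV. e a $ c *\<^sub>R axis c 1)"
      by (simp add: vec_eq_iff axis_def if_distrib cong: if_cong)
    then have "l (e a) = l (\<Sum>c\<in>UNIV. e a $ c *\<^sub>R axis c 1)" by simp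
    then show ?thesis by (simp add: linear_sum[OF l] linear_scale[OF l])
  qed
  have "(\<Sum>a\<in>UNIV. (norm (l (e a)))\<^sup>2)
     = (\<Sum>a\<in>UNIV. \<Sum>c\<in>UNIV. \<Sum>d\<in>UNIV. (e a $ c * e a $ d) * (l (axis c 1) \<bullet> l (axis d 1)))"
    unfolding power2_norm_eq_inner le inner_sum_left inner_sum_right by (simp add: mult_ac inner_commute)
  also have "\<dots> = (\<Sum>c\<in>UNIV. \<Sum>a\<in>UNIV. \<Sum>d\<in>UNIV. (e a $ c * e a $ d) * (l (axis c 1) \<bullet> l (axis d 1)))"
    by (rule sum.swap)
  also have "\<dots> = (\<Sum>c\<in>UNIV. \<Sum>d\<in>UNIV. \<Sum>a\<in>UNIV. (e a $ c * e a $ d) * (l (axis c 1) \<bullet> l (axis d 1)))"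
    by (rule sum.cong[OF refl], rule sum.swap)
  also have "\<dots> = (\<Sum>c\<in>UNIV. (norm (l (axis c 1)))\<^sup>2 / \<gamma> c)"
    unfolding sum_distrib_right[symmetric] col power2_norm_eq_inner
    by (simp add: if_distrib if_distribR cong: if_cong)
  finally show ?thesis .
qed

section \<open>The first two derivatives of the parametrization\<close>

lemma has_derivative_vec_lambda:
  fixes g :: "'j::finite \<Rightarrow> 'a::real_normed_vector \<Rightarrow> 'b::euclidean_space"
  assumes "\<And>j. (g j has_derivative g' j) F"
  shows "((\<lambda>x. \<chi> j. g j x) has_derivative (\<lambda>h. \<chi> j. g' j h)) F"
proof -
  have eq: "(\<chi> j. k j) = (\<Sum>j\<in>UNIV. axis j (k j :: 'b))" for k
    by (simp add: vec_eq_iff axis_def if_distrib cong: if_cong)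
  have ax: "bounded_linear (axis j :: 'b \<Rightarrow> 'b^'j)" for j
    unfolding linear_conv_bounded_linear[symmetric]
    by (rule linearI) (auto simp: vec_eq_iff axis_def)
  have "((\<lambda>x. \<Sum>j\<in>UNIV. axis j (g j x)) has_derivative (\<lambda>h. \<Sum>j\<in>UNIV. axis j (g' j h))) F"
    by (intro has_derivative_sum bounded_linear.has_derivative[OF ax] assms)
  then show ?thesis by (simp only: eq)
qed

definition rot :: "real^'k \<Rightarrow> 'k \<Rightarrow> real^('k option) \<Rightarrow> complex" where
  "rot lam j x = exp (\<i> * complex_of_real (lam $ j * x $ None))"

lemma norm_rot: "norm (rot lam j x) = 1"
  by (simp add: rot_def norm_exp_i_times)

lemma rot_inner: "rot lam j x \<bullet> rot lam j x = 1" "(\<i> * rot lam j x) \<bullet> (\<i> * rot lam j x) = 1"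
  "rot lam j x \<bullet> (\<i> * rot lam j x) = 0" "(\<i> * rot lam j x) \<bullet> rot lam j x = 0"
  using norm_rot[of lam j x] by (simp_all add: norm_eq_1[symmetric] norm_mult) (simp_all add: inner_complex_def)

lemma complex_norm_sq_frame:
  assumes "norm c = 1"
  shows "(a :: complex) \<bullet> a = (a \<bullet> c)\<^sup>2 + (a \<bullet> (\<i> * c))\<^sup>2"
proof -
  have "(Re c)\<^sup>2 + (Im c)\<^sup>2 = 1" using assms by (simp add: cmod_def)
  then have "a \<bullet> a = ((Re a)\<^sup>2 + (Im a)\<^sup>2) * ((Re c)\<^sup>2 + (Im c)\<^sup>2)"
    by (simp add: inner_complex_def power2_eq_square)
  then show ?thesis by (simp add: inner_complex_def power2_eq_square algebra_simps)
qed

lemma rot_derivative: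
  fixes lam :: "real^'k"
  shows "((\<lambda>x. rot lam j x) has_derivative (\<lambda>h. complex_of_real (lam $ j * h $ None) * (\<i> * rot lam j x))) (at x)"
proof -
  have n: "((\<lambda>x::real^('k option). x $ None) has_derivative (\<lambda>h. h $ None)) (at x)"
    by (intro bounded_linear.has_derivative[OF bounded_linear_vec_nth] has_derivative_ident)
  have "((\<lambda>x. \<i> * complex_of_real (lam $ j * x $ None)) has_derivative
      (\<lambda>h. \<i> * complex_of_real (lam $ j * h $ None))) (at x)"
    by (intro has_derivative_mult_right has_derivative_of_real n)
  moreover have "(exp has_derivative (\<lambda>h. exp a * h)) (at a)" for a :: complex
    using DERIV_exp[of a] by (simp add: has_field_derivative_def)
  ultimately show ?thesis unfolding rot_def
    by (rule has_derivative_eq_rhs[OF has_derivative_compose]) (simp add: fun_eq_iff mult_ac)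
qed

definition dhel :: "real^'k \<Rightarrow> real^('k option) \<Rightarrow> real^('k option) \<Rightarrow> (complex^'k) \<times> real" where
  "dhel lam x h = ((\<chi> j. complex_of_real (h $ Some j) * rot lam j x
      + complex_of_real (x $ Some j * lam $ j * h $ None) * (\<i> * rot lam j x)), h $ None)"

lemma nth_derivative: "((\<lambda>x::real^'n. x $ c) has_derivative (\<lambda>h. h $ c)) (at x)"
  by (intro bounded_linear.has_derivative[OF bounded_linear_vec_nth] has_derivative_ident)

lemma helicoid_derivative: "(helicoid lam has_derivative dhel lam x) (at x)"
proof -
  have "((\<lambda>x. complex_of_real (x $ Some j) * rot lam j x) has_derivative
      (\<lambda>h. complex_of_real (h $ Some j) * rot lam j x
        + complex_of_real (x $ Some j * lam $ j * h $ None) * (\<i> * rot lam j x))) (at x)" for j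
    by (rule has_derivative_eq_rhs[OF has_derivative_mult[OF has_derivative_of_real[OF nth_derivative] rot_derivative]])
       (simp add: fun_eq_iff mult_ac)
  then have "((\<lambda>x. ((\<chi> j. complex_of_real (x $ Some j) * rot lam j x), x $ None)) has_derivative dhel lam x) (at x)"
    unfolding dhel_def[abs_def] by (intro has_derivative_Pair has_derivative_vec_lambda nth_derivative)
  then show ?thesis unfolding rot_def helicoid_def[abs_def] .
qed

lemma frechet_helicoid: "frechet_derivative (helicoid lam) (at x) = dhel lam x"
  by (rule frechet_derivative_at[OF helicoid_derivative, symmetric])

lemma helicoid_differentiable: "helicoid lam differentiable (at x)"
  using helicoid_derivative differentiable_def by blast

definition ddhel :: "real^'k \<Rightarrow> real^('k option) \<Rightarrow> real^('k option) \<Rightarrow> real^('k option) \<Rightarrow> (complex^'k) \<times> real" where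
  "ddhel lam x v h = ((\<chi> j. complex_of_real (lam $ j * (h $ Some j * v $ None + v $ Some j * h $ None)) * (\<i> * rot lam j x)
      - complex_of_real (x $ Some j * lam $ j * h $ None * (lam $ j * v $ None)) * rot lam j x), 0)"

lemma dhel_derivative: "((\<lambda>q. dhel lam q h) has_derivative (\<lambda>v. ddhel lam x v h)) (at x)"
proof -
  have 1: "((\<lambda>q. complex_of_real (h $ Some j) * rot lam j q) has_derivative
      (\<lambda>v. complex_of_real (h $ Some j) * (complex_of_real (lam $ j * v $ None) * (\<i> * rot lam j x)))) (at x)" for j
    by (intro has_derivative_mult_right rot_derivative)
  have 2: "((\<lambda>q. complex_of_real (q $ Some j * lam $ j * h $ None)) has_derivative
      (\<lambda>v. complex_of_real (v $ Some j * lam $ j * h $ None))) (at x)" for j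
    by (intro has_derivative_of_real has_derivative_mult_left nth_derivative)
  have 3: "((\<lambda>q. \<i> * rot lam j q) has_derivative
      (\<lambda>v. \<i> * (complex_of_real (lam $ j * v $ None) * (\<i> * rot lam j x)))) (at x)" for j
    by (intro has_derivative_mult_right rot_derivative)
  have "((\<lambda>q. complex_of_real (h $ Some j) * rot lam j q
      + complex_of_real (q $ Some j * lam $ j * h $ None) * (\<i> * rot lam j q)) has_derivative
     (\<lambda>v. complex_of_real (lam $ j * (h $ Some j * v $ None + v $ Some j * h $ None)) * (\<i> * rot lam j x)
      - complex_of_real (x $ Some j * lam $ j * h $ None * (lam $ j * v $ None)) * rot lam j x)) (at x)" for j
    by (rule has_derivative_eq_rhs, rule has_derivative_add[OF 1 has_derivative_mult[OF 2 3]])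
       (simp add: fun_eq_iff algebra_simps)
  then show ?thesis
    unfolding dhel_def ddhel_def by (intro has_derivative_Pair has_derivative_vec_lambda has_derivative_const)
qed

lemma second_derivative_helicoid:
  "frechet_derivative (\<lambda>q. frechet_derivative (helicoid lam) (at q) w) (at p) v = ddhel lam p v w"
  unfolding frechet_helicoid by (rule fun_cong[OF frechet_derivative_at[OF dhel_derivative, symmetric]])

text \<open>This is W^2, the squared length of \<partial>F/\<partial>s. The coordinate vectors are
  orthogonal and the ruling directions have length 1, so it is also the Gram determinant.\<close>

definition hel_weight :: "real^'k \<Rightarrow> real^('k option) \<Rightarrow> real" where
  "hel_weight lam x = 1 + (\<Sum>j\<in>UNIV. (lam $ j * x $ Some j)\<^sup>2)"

definition hel_metric :: "real^'k \<Rightarrow> real^('k option) \<Rightarrow> 'k option \<Rightarrow> real" where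
  "hel_metric lam x c = (case c of None \<Rightarrow> hel_weight lam x | Some j \<Rightarrow> 1)"

lemma hel_weight_pos: "hel_weight lam x > 0"
  unfolding hel_weight_def by (intro add_pos_nonneg sum_nonneg) auto

lemma hel_metric_pos: "hel_metric lam x c > 0"
  by (auto simp: hel_metric_def hel_weight_pos split: option.splits)

lemma inner_dhel: "dhel lam x v \<bullet> dhel lam x w = (\<Sum>c\<in>UNIV. hel_metric lam x c * v $ c * w $ c)"
proof -
  have r: "(complex_of_real a * rot lam j x + complex_of_real b * (\<i> * rot lam j x)) \<bullet>
     (complex_of_real a' * rot lam j x + complex_of_real b' * (\<i> * rot lam j x)) = a * a' + b * b'" for a b a' b' j
    by (simp add: scaleR_conv_of_real[symmetric] inner_add_left inner_add_right rot_inner)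
  have "dhel lam x v \<bullet> dhel lam x w = (\<Sum>j\<in>UNIV. v $ Some j * w $ Some j
     + x $ Some j * lam $ j * v $ None * (x $ Some j * lam $ j * w $ None)) + v $ None * w $ None"
    unfolding dhel_def by (simp add: inner_vec_def r del: of_real_mult)
  also have "\<dots> = (\<Sum>c\<in>UNIV. hel_metric lam x c * v $ c * w $ c)"
    by (simp add: sum_UNIV_option hel_metric_def hel_weight_def sum.distrib distrib_right distrib_left sum_distrib_left power2_eq_square mult_ac)
  finally show ?thesis .
qed

lemma sum_mult_axis: "(\<Sum>c\<in>UNIV. g c * axis i a $ c * axis j b $ c) = (if i = j then g i * a * (b :: real) else 0)"
  by (auto simp: axis_def mult_delta_left mult_delta_right intro!: sum.neutral)

lemma volume_density_helicoid: "volume_density (helicoid lam) x = sqrt (hel_weight lam x)"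
proof -
  have "(\<chi> i j. frechet_derivative (helicoid lam) (at x) (axis i 1) \<bullet> frechet_derivative (helicoid lam) (at x) (axis j 1))
     = (\<chi> i j. if i = j then hel_metric lam x i else 0)"
    unfolding frechet_helicoid inner_dhel
    by (simp add: vec_eq_iff sum_mult_axis)
  then show ?thesis
    unfolding volume_density_def
    by (simp add: det_diagonal prod_UNIV_option) (simp add: hel_metric_def)
qed

lemma orthonormal_frame_helicoid:
  "orthonormal_frame_at (helicoid lam) x e \<longleftrightarrow>
    (\<forall>a b. (\<Sum>c\<in>UNIV. hel_metric lam x c * e a $ c * e b $ c) = (if a = b then 1 else 0))"
  unfolding orthonormal_frame_at_def frechet_helicoid inner_dhel ..

text \<open>The normalized coordinate vectors form a frame, so the choice in
  \<open>second_variation\<close> does pick an orthonormal one.\<close>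

lemma orthonormal_frame_helicoid_some:
  "orthonormal_frame_at (helicoid lam) x (SOME e. orthonormal_frame_at (helicoid lam) x e)"
proof -
  have "orthonormal_frame_at (helicoid lam) x (\<lambda>a. axis a (1 / sqrt (hel_metric lam x a)))"
    unfolding orthonormal_frame_helicoid using hel_metric_pos[of lam x]
    by (simp add: sum_mult_axis less_imp_le less_imp_neq[THEN not_sym])
  then show ?thesis by (rule someI[of "orthonormal_frame_at (helicoid lam) x"])
qed

text \<open>With the vertical direction these vectors form an orthonormal basis of the complement of
  the rulings. They depend on s alone, hence are constant along each ruling.\<close>

definition nu :: "real^'k \<Rightarrow> 'k \<Rightarrow> real^('k option) \<Rightarrow> (complex^'k) \<times> real" where
  "nu lam j x = (axis j (\<i> * rot lam j x), 0)"

lemma inner_nu: "A \<bullet> nu lam j x = fst A $ j \<bullet> (\<i> * rot lam j x)"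
  by (cases A) (simp add: nu_def inner_axis)

lemma nu_cong: "x $ None = x' $ None \<Longrightarrow> nu lam j x = nu lam j x'"
  by (simp add: nu_def rot_def)

lemma dhel_Some: "dhel lam x (axis (Some j) 1) = (axis j (rot lam j x), 0)"
  by (auto simp: dhel_def vec_eq_iff axis_def)

lemma inner_dhel_Some: "A \<bullet> dhel lam x (axis (Some j) 1) = fst A $ j \<bullet> rot lam j x"
  by (cases A) (simp add: dhel_Some inner_axis)

lemma dhel_None: "dhel lam x (axis None 1) = ((\<chi> j. (x $ Some j * lam $ j) *\<^sub>R (\<i> * rot lam j x)), 1)"
  by (auto simp: dhel_def vec_eq_iff axis_def scaleR_conv_of_real)

lemma inner_dhel_None:
  "A \<bullet> dhel lam x (axis None 1) = (\<Sum>j\<in>UNIV. lam $ j * x $ Some j * (A \<bullet> nu lam j x)) + snd A"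
  by (cases A) (simp add: dhel_None inner_vec_def inner_nu mult_ac)

lemma norm_sq_frame:
  assumes "\<And>j. A \<bullet> dhel lam x (axis (Some j) 1) = 0"
  shows "A \<bullet> A = (\<Sum>j\<in>UNIV. (A \<bullet> nu lam j x)\<^sup>2) + (snd A)\<^sup>2"
proof -
  obtain a g where A: "A = (a, g)" by (cases A)
  have "a $ j \<bullet> a $ j = (A \<bullet> nu lam j x)\<^sup>2" for j
    using complex_norm_sq_frame[OF norm_rot, of "a $ j" lam j x] assms[of j]
    by (simp add: inner_dhel_Some inner_nu A)
  then show ?thesis by (simp add: A inner_vec_def power2_eq_square)
qed

lemma inner_ddhel:
  assumes "\<And>j. A \<bullet> dhel lam x (axis (Some j) 1) = 0"
  shows "A \<bullet> ddhel lam x v h = (\<Sum>j\<in>UNIV. lam $ j * (h $ Some j * v $ None + v $ Some j * h $ None) * (A \<bullet> nu lam j x))"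
proof -
  obtain a g where A: "A = (a, g)" by (cases A)
  have z: "a $ j \<bullet> rot lam j x = 0" for j using assms[of j] by (simp add: inner_dhel_Some A)
  have "a $ j \<bullet> (complex_of_real s * (\<i> * rot lam j x) - complex_of_real t * rot lam j x)
      = s * (a $ j \<bullet> (\<i> * rot lam j x))" for s t j
    by (simp add: scaleR_conv_of_real[symmetric] inner_diff_right z)
  then show ?thesis
    unfolding ddhel_def A by (simp add: inner_vec_def inner_nu del: of_real_mult of_real_add)
qed

text \<open>Paired with a normal vector, the second fundamental form has only mixed entries between
  a ruling direction and \<partial>F/\<partial>s. Symmetry gives the factor 2 and the length of
  \<partial>F/\<partial>s the denominator W^2. The frame is summed out first in \<open>b\<close>,
  then in \<open>a\<close>.\<close>

lemma second_fundamental_form_sum: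
  fixes lam :: "real^'k"
  assumes e: "orthonormal_frame_at (helicoid lam) x e"
    and V: "A \<in> orthogonal_comp (tangent_space (helicoid lam) x)"
  shows "(\<Sum>a\<in>UNIV. \<Sum>b\<in>UNIV. (second_fundamental_form (helicoid lam) x (e a) (e b) \<bullet> A)\<^sup>2)
     = 2 * (\<Sum>j\<in>UNIV. (lam $ j * (A \<bullet> nu lam j x))\<^sup>2) / hel_weight lam x"
proof -
  let ?f = "\<lambda>j. A \<bullet> nu lam j x"
  define q where "q v h = (\<Sum>j\<in>UNIV. lam $ j * (h $ Some j * v $ None + v $ Some j * h $ None) * ?f j)"
    for v h :: "real^('k option)"
  have N: "A \<bullet> dhel lam x h = 0" for h
    using V unfolding orthogonal_comp_def tangent_space_def frechet_helicoid orthogonal_def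
    by (auto simp: inner_commute)
  have II: "second_fundamental_form (helicoid lam) x v h \<bullet> A = q v h" for v h
    unfolding second_fundamental_form_def inner_normal_part[OF helicoid_differentiable V]
      second_derivative_helicoid q_def
    by (subst inner_commute) (rule inner_ddhel[OF N])
  have ee: "(\<Sum>c\<in>UNIV. hel_metric lam x c * e a $ c * e b $ c) = (if a = b then 1 else 0)" for a b
    using e unfolding orthonormal_frame_helicoid by blast
  note fs = orthonormal_frame_sum[OF hel_metric_pos ee]
  have m: "hel_metric lam x (Some j) = 1" "hel_metric lam x None = hel_weight lam x" for j
    by (simp_all add: hel_metric_def)
  have "(\<Sum>b\<in>UNIV. (q v (e b))\<^sup>2) = (\<Sum>j\<in>UNIV. (lam $ j * v $ None * ?f j)\<^sup>2)
      + (\<Sum>j\<in>UNIV. lam $ j * v $ Some j * ?f j)\<^sup>2 / hel_weight lam x" for v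
  proof -
    have "linear (q v)"
      by (rule linearI) (simp_all add: q_def algebra_simps sum.distrib sum_distrib_left)
    from fs[OF this] have "(\<Sum>b\<in>UNIV. (q v (e b))\<^sup>2) = (\<Sum>c\<in>UNIV. (q v (axis c 1))\<^sup>2 / hel_metric lam x c)"
      by simp
    also have "q v (axis None 1) = (\<Sum>j\<in>UNIV. lam $ j * v $ Some j * ?f j)"
      by (simp add: q_def axis_def)
    moreover have "q v (axis (Some i) 1) = lam $ i * v $ None * ?f i" for i
      by (simp add: q_def axis_def mult_delta_left mult_delta_right)
    ultimately show ?thesis by (simp add: sum_UNIV_option m)
  qed
  moreover have "(\<Sum>a\<in>UNIV. (lam $ j * e a $ None * ?f j)\<^sup>2) = (lam $ j * ?f j)\<^sup>2 / hel_weight lam x" for j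
  proof -
    have "linear (\<lambda>v::real^('k option). lam $ j * v $ None * ?f j)" by (rule linearI) (simp_all add: algebra_simps)
    from fs[OF this] show ?thesis by (simp add: sum_UNIV_option m axis_def)
  qed
  moreover have "(\<Sum>a\<in>UNIV. (\<Sum>j\<in>UNIV. lam $ j * e a $ Some j * ?f j)\<^sup>2) = (\<Sum>j\<in>UNIV. (lam $ j * ?f j)\<^sup>2)"
  proof -
    have "linear (\<lambda>v::real^('k option). \<Sum>j\<in>UNIV. lam $ j * v $ Some j * ?f j)"
      by (rule linearI) (simp_all add: algebra_simps sum.distrib sum_distrib_left)
    from fs[OF this] show ?thesis
      by (simp add: sum_UNIV_option m axis_def mult_delta_left mult_delta_right)
  qed
  moreover have "(\<Sum>a\<in>UNIV. \<Sum>j\<in>UNIV. (lam $ j * e a $ None * ?f j)\<^sup>2) = (\<Sum>j\<in>UNIV. \<Sum>a\<in>UNIV. (lam $ j * e a $ None * ?f j)\<^sup>2)"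
    by (rule sum.swap)
  ultimately show ?thesis
    unfolding II by (simp add: sum.distrib sum_divide_distrib[symmetric])
qed

text \<open>The frame sum equals the sum over normalized coordinate directions, and the contribution
  of \<partial>F/\<partial>s is nonnegative.\<close>

lemma normal_connection_sum:
  assumes e: "orthonormal_frame_at (helicoid lam) x e" and V: "V differentiable (at x)"
  shows "(\<Sum>a\<in>UNIV. (norm (normal_connection (helicoid lam) V x (e a)))\<^sup>2)
     \<ge> (\<Sum>i\<in>UNIV. (norm (normal_connection (helicoid lam) V x (axis (Some i) 1)))\<^sup>2)"
proof -
  have ee: "(\<Sum>c\<in>UNIV. hel_metric lam x c * e a $ c * e b $ c) = (if a = b then 1 else 0)" for a b
    using e unfolding orthonormal_frame_helicoid by blast
  have "linear (normal_connection (helicoid lam) V x)"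
    unfolding normal_connection_def[abs_def]
    using linear_compose[OF linear_frechet_derivative[OF V] linear_normal_part[OF helicoid_differentiable]]
    by (simp add: o_def)
  from orthonormal_frame_sum[OF hel_metric_pos ee this] show ?thesis
    using hel_weight_pos[of lam x] by (simp add: sum_UNIV_option hel_metric_def)
qed

text \<open>For a vector orthogonal to the rulings, \<partial>F/\<partial>s is the only tangent
  direction to project out.\<close>

lemma normal_part_norm:
  assumes "\<And>j. A \<bullet> dhel lam x (axis (Some j) 1) = 0"
  shows "(norm (normal_part (helicoid lam) x A))\<^sup>2
    = A \<bullet> A - (A \<bullet> dhel lam x (axis None 1))\<^sup>2 / hel_weight lam x"
proof -
  let ?\<xi> = "dhel lam x (axis None 1)"
  let ?w = "hel_weight lam x"
  let ?c = "(A \<bullet> ?\<xi>) / ?w"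
  have \<xi>: "?\<xi> \<bullet> ?\<xi> = ?w" "?\<xi> \<bullet> dhel lam x (axis (Some j) 1) = 0" for j
    by (simp_all add: inner_dhel sum_mult_axis) (simp add: hel_metric_def)
  have lin: "linear (dhel lam x)"
    using linear_frechet_derivative[OF helicoid_differentiable[of lam x]] by (simp add: frechet_helicoid)
  have "dhel lam x h \<bullet> (A - ?c *\<^sub>R ?\<xi>) = 0" for h
  proof -
    have "h = (\<Sum>c\<in>UNIV. h $ c *\<^sub>R axis c 1)"
      by (simp add: vec_eq_iff axis_def mult_delta_right)
    then have "dhel lam x h = dhel lam x (\<Sum>c\<in>UNIV. h $ c *\<^sub>R axis c 1)" by simp
    also have "\<dots> = (\<Sum>c\<in>UNIV. h $ c *\<^sub>R dhel lam x (axis c 1))"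
      by (simp add: linear_sum[OF lin] linear_scale[OF lin])
    finally have h: "dhel lam x h = (\<Sum>c\<in>UNIV. h $ c *\<^sub>R dhel lam x (axis c 1))" .
    have "dhel lam x (axis c 1) \<bullet> (A - ?c *\<^sub>R ?\<xi>) = 0" for c
      using hel_weight_pos[of lam x] assms \<xi>
      by (cases c) (simp_all add: inner_diff_right inner_commute)
    then show ?thesis unfolding h inner_sum_left by simp
  qed
  then have "A - ?c *\<^sub>R ?\<xi> \<in> orthogonal_comp (tangent_space (helicoid lam) x)"
    unfolding orthogonal_comp_def tangent_space_def frechet_helicoid orthogonal_def by auto
  moreover have "A - (A - ?c *\<^sub>R ?\<xi>) = dhel lam x (?c *\<^sub>R axis None 1)"
    by (simp add: linear_scale[OF lin])
  then have "A - (A - ?c *\<^sub>R ?\<xi>) \<in> tangent_space (helicoid lam) x"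
    unfolding tangent_space_def frechet_helicoid by simp
  ultimately have "normal_part (helicoid lam) x A = A - ?c *\<^sub>R ?\<xi>"
    by (intro normal_part_eqI helicoid_differentiable)
  then have "(norm (normal_part (helicoid lam) x A))\<^sup>2 = A \<bullet> A - 2 * ?c * (A \<bullet> ?\<xi>) + ?c * ?c * ?w"
    by (simp only: power2_norm_eq_inner) (simp add: inner_diff_left inner_diff_right \<xi> inner_commute[of ?\<xi> A])
  then show ?thesis
    using hel_weight_pos[of lam x] by (simp add: power2_eq_square)
qed

text \<open>Near-maximizers \<sigma> and \<tau> are chosen at a loss \<open>\<epsilon>\<close>, so
  attainment of the suprema does not matter. The shifts \<open>bt\<close> solve a (bt + bt^2) =
  \<tau>, and a bt is then half of the summand in \<open>mu\<close>.\<close>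

lemma scalar_mu_extract:
  fixes lam :: "real^'k"
  assumes "m \<le> (SUP \<sigma>\<in>{0..L}. C * \<sigma> + mu (\<chi> j. sqrt ((lam $ j)\<^sup>2 - \<sigma>)))" "\<epsilon> > 0" "L \<ge> 0" "\<And>j. L \<le> (lam $ j)\<^sup>2"
  obtains \<sigma> \<tau> bt where "0 \<le> \<sigma>" "\<sigma> \<le> L" "0 \<le> \<tau>"
    "\<forall>j. ((lam $ j)\<^sup>2 - \<sigma>) * (bt j + (bt j)\<^sup>2) \<le> \<tau>"
    "0 \<le> (\<Sum>j\<in>UNIV. ((lam $ j)\<^sup>2 - \<sigma>) * bt j) - \<tau>"
    "m - \<epsilon> \<le> C * \<sigma> + ((\<Sum>j\<in>UNIV. ((lam $ j)\<^sup>2 - \<sigma>) * bt j) - \<tau>)"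
proof -
  have "m - \<epsilon> < (SUP \<sigma>\<in>{0..L}. C * \<sigma> + mu (\<chi> j. sqrt ((lam $ j)\<^sup>2 - \<sigma>)))" using assms by linarith
  then have "\<exists>\<sigma>\<in>{0..L}. m - \<epsilon> < C * \<sigma> + mu (\<chi> j. sqrt ((lam $ j)\<^sup>2 - \<sigma>))"
    using less_cSupD[of "(\<lambda>\<sigma>. C * \<sigma> + mu (\<chi> j. sqrt ((lam $ j)\<^sup>2 - \<sigma>))) ` {0..L}"] assms(3)
    by auto
  then obtain \<sigma> where \<sigma>: "0 \<le> \<sigma>" "\<sigma> \<le> L" "m - \<epsilon> < C * \<sigma> + mu (\<chi> j. sqrt ((lam $ j)\<^sup>2 - \<sigma>))"
    by auto
  define a where "a j = (lam $ j)\<^sup>2 - \<sigma>" for j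
  have a: "a j \<ge> 0" for j using assms(4)[of j] \<sigma> by (simp add: a_def)
  define val where "val \<tau> = (1/2) * (\<Sum>j\<in>UNIV. sqrt ((a j)\<^sup>2 + 4 * a j * \<tau>) - a j) - \<tau>" for \<tau>
  have mu: "mu (\<chi> j. sqrt ((lam $ j)\<^sup>2 - \<sigma>)) = (SUP \<tau>\<in>{0..}. val \<tau>)"
  proof -
    have p4: "sqrt (a j) ^ 4 = (a j)\<^sup>2" for j
    proof -
      have "sqrt (a j) ^ 4 = ((sqrt (a j))\<^sup>2)\<^sup>2" by simp
      then show ?thesis using a[of j] by simp
    qed
    show ?thesis unfolding mu_def val_def using a by (simp add: a_def[symmetric] p4)
  qed
  have "m - \<epsilon> - C * \<sigma> < (SUP \<tau>\<in>{0..}. val \<tau>)" using \<sigma>(3) mu by simp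
  then obtain \<tau>0 where \<tau>0: "0 \<le> \<tau>0" "m - \<epsilon> - C * \<sigma> < val \<tau>0"
    using less_cSupD[of "val ` {0..}"] by auto
  have v0: "val 0 = 0" using a by (simp add: val_def)
  \<comment> \<open>Falling back on \<tau> = 0, where the value is 0, keeps the coefficient
    nonnegative, so that later |V|^2 may be replaced by |f|^2.\<close>
  define \<tau> where "\<tau> = (if val \<tau>0 \<ge> 0 then \<tau>0 else 0)"
  have \<tau>: "0 \<le> \<tau>" "0 \<le> val \<tau>" "m - \<epsilon> - C * \<sigma> < val \<tau>" using \<tau>0 v0 by (auto simp: \<tau>_def)
  \<comment> \<open>When \<open>a j = 0\<close>, division by zero gives \<open>bt j = 0\<close>,
    which fits the formula for \<open>a j * bt j\<close>.\<close>
  define bt where "bt j = (sqrt ((a j)\<^sup>2 + 4 * a j * \<tau>) - a j) / (2 * a j)" for j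
  have ab: "a j * bt j = (sqrt ((a j)\<^sup>2 + 4 * a j * \<tau>) - a j) / 2" for j
    by (cases "a j = 0") (simp_all add: bt_def)
  have sum: "(\<Sum>j\<in>UNIV. a j * bt j) - \<tau> = val \<tau>"
    by (simp add: ab val_def sum_divide_distrib)
  have "a j * (bt j + (bt j)\<^sup>2) \<le> \<tau>" for j
  proof (cases "a j = 0")
    case False
    define s where "s = sqrt ((a j)\<^sup>2 + 4 * a j * \<tau>)"
    have s: "s\<^sup>2 = (a j)\<^sup>2 + 4 * a j * \<tau>" using a[of j] \<tau> by (simp add: s_def)
    have "s = a j + 2 * a j * bt j" using False by (simp add: bt_def s_def)
    then have "a j * (bt j + (bt j)\<^sup>2) = (s\<^sup>2 - (a j)\<^sup>2) / (4 * a j)"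
      using False by (simp add: field_simps power2_eq_square)
    also have "\<dots> = \<tau>" using False by (simp add: s)
    finally show ?thesis by simp
  qed (use \<tau> in simp)
  then show ?thesis
    using that[of \<sigma> \<tau> bt] \<sigma> \<tau> sum unfolding a_def by auto
qed

section \<open>Stability\<close>

text \<open>As \<open>m\<close> is constant along \<open>v\<close>, only \<open>G\<close> is
  differentiated; this is used with \<open>nu\<close>, the ruling directions and the vertical
  vector.\<close>

lemma has_dir_deriv_inner:
  fixes G m :: "'a::real_normed_vector \<Rightarrow> 'b::real_inner"
  assumes G: "\<And>x. G differentiable (at x)" and m: "\<And>x t. m (x + t *\<^sub>R v) = m x"
  shows "has_dir_deriv (\<lambda>x. G x \<bullet> m x) (\<lambda>x. frechet_derivative G (at x) v \<bullet> m x) v"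
  unfolding has_dir_deriv_def
proof
  fix x
  have lin: "linear (frechet_derivative G (at x))" by (rule linear_frechet_derivative[OF G])
  have "((\<lambda>t. x + t *\<^sub>R v) has_derivative (\<lambda>t. t *\<^sub>R v)) (at 0)"
    by (auto intro!: derivative_eq_intros)
  moreover have "(G has_derivative frechet_derivative G (at x)) (at (x + 0 *\<^sub>R v))"
    using G[of x] by (simp add: frechet_derivative_works)
  ultimately have "((\<lambda>t. G (x + t *\<^sub>R v)) has_derivative (\<lambda>t. frechet_derivative G (at x) (t *\<^sub>R v))) (at 0)"
    by (rule has_derivative_compose)
  then have "((\<lambda>t. G (x + t *\<^sub>R v) \<bullet> m x) has_derivative (\<lambda>t. frechet_derivative G (at x) (t *\<^sub>R v) \<bullet> m x)) (at 0)"
    by (rule has_derivative_inner_left)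
  then show "((\<lambda>t. G (x + t *\<^sub>R v) \<bullet> m (x + t *\<^sub>R v)) has_real_derivative frechet_derivative G (at x) v \<bullet> m x) (at 0)"
    by (simp add: m has_field_derivative_def linear_scale[OF lin] mult.commute[of _ "_ \<bullet> _"] )
qed

lemma continuous_differentiable: "(\<And>x. G differentiable (at x)) \<Longrightarrow> continuous_on UNIV G"
  by (simp add: continuous_at_imp_continuous_on differentiable_imp_continuous_within)

lemma continuous_nu: "continuous_on UNIV (nu lam j)"
proof -
  have "continuous_on UNIV (rot lam j)"
    using rot_derivative[of lam j] by (intro continuous_differentiable) (auto simp: differentiable_def)
  moreover have "nu lam j x = ((\<chi> i. if i = j then \<i> * rot lam j x else 0), 0)" for x
    by (auto simp: nu_def axis_def vec_eq_iff)
  then have "nu lam j = (\<lambda>x. ((\<chi> i. if i = j then \<i> * rot lam j x else 0), 0))" by auto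
  moreover have "continuous_on UNIV (\<lambda>x. ((\<chi> i. if i = j then \<i> * rot lam j x else 0) :: complex^'a, 0 :: real))"
  proof (intro continuous_on_Pair continuous_on_vec_lambda continuous_on_const)
    fix i
    show "continuous_on UNIV (\<lambda>x. if i = j then \<i> * rot lam j x else 0)"
      using \<open>continuous_on UNIV (rot lam j)\<close> by (cases "i = j") (auto intro!: continuous_intros)
  qed
  ultimately show ?thesis by simp
qed

lemma helicoid_stable:
  fixes lam :: "real^'k"
  assumes k3: "CARD('k) \<ge> 3" and pos: "\<And>j. lam $ j > 0"
    and L: "L \<ge> 0" "\<And>j. L \<le> (lam $ j)\<^sup>2" and \<Lambda>: "\<And>j. (lam $ j)\<^sup>2 \<le> \<Lambda>"
    and sup: "2 * \<Lambda> \<le> (SUP \<sigma>\<in>{0..L}. ((real CARD('k) - 1)\<^sup>2 + 4) / 4 * \<sigma> + mu (\<chi> j. sqrt ((lam $ j)\<^sup>2 - \<sigma>)))"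
  shows "stable_submanifold (helicoid lam)"
  unfolding stable_submanifold_def
proof (intro allI impI)
  fix V assume V: "compactly_supported_normal_field (helicoid lam) V"
  define DV where "DV v x = frechet_derivative V (at x) v" for v x
  have sm: "ck (Suc (Suc 0)) V" using V by (simp add: compactly_supported_normal_field_def smooth_def)
  have V1: "V differentiable (at x)" and V2: "DV v differentiable (at x)"
    and V3: "continuous_on UNIV (\<lambda>x. frechet_derivative (DV v) (at x) h)" for x v h
    using sm unfolding DV_def[abs_def] by auto
  have nrm: "V x \<in> orthogonal_comp (tangent_space (helicoid lam) x)" for x
    using V by (simp add: compactly_supported_normal_field_def)
  have V0: "V x \<bullet> dhel lam x h = 0" for x h
    using nrm[of x] unfolding orthogonal_comp_def tangent_space_def frechet_helicoid orthogonal_def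
    by (auto simp: inner_commute)
  \<comment> \<open>Scaling by 1/lam_i makes \<open>v i\<close> the direction
    \<partial>/\<partial>y_i for y_i = lam_i u_i.\<close>
  define v :: "'k \<Rightarrow> real^('k option)" where "v i = axis (Some i) (1 / lam $ i)" for i
  define y where "y j x = lam $ j * x $ Some j" for j and x :: "real^('k option)"
  define f where "f j x = V x \<bullet> nu lam j x" for j x
  define B where "B i j x = DV (v i) x \<bullet> nu lam j x" for i j x
  define H where "H l i j x = frechet_derivative (DV (v i)) (at x) (v l) \<bullet> nu lam j x" for l i j x
  have vN: "(x + t *\<^sub>R v i) $ None = x $ None" for x t i by (simp add: v_def axis_def)
  have nuv: "nu lam j (x + t *\<^sub>R v i) = nu lam j x" for j x t i by (rule nu_cong) (rule vN)
  note ci = continuous_on_inner[OF _ continuous_nu]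
  have df: "has_dir_deriv (f j) (B i j) (v i)" for i j
    unfolding f_def[abs_def] B_def[abs_def] DV_def by (rule has_dir_deriv_inner[OF V1 nuv])
  have dB: "has_dir_deriv (B i j) (H l i j) (v l)" for i j l
    unfolding H_def[abs_def] B_def[abs_def] by (rule has_dir_deriv_inner[OF V2 nuv])
  have cH: "continuous_on UNIV (H l i j)" for l i j
    unfolding H_def[abs_def] by (rule ci[OF V3])
  interpret S: section_data v y f B H
  proof
    show "has_dir_deriv (y j) (\<lambda>_. of_bool (i = j)) (v i)" for i j
      unfolding has_dir_deriv_def y_def using pos[of j]
      by (auto simp: v_def axis_def distrib_left intro!: derivative_eq_intros)
    show "continuous_on UNIV (y j)" for j unfolding y_def[abs_def] by (intro continuous_intros)
    show "continuous_on UNIV (f j)" for j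
      unfolding f_def[abs_def] by (rule ci[OF continuous_differentiable[OF V1]])
    show "continuous_on UNIV (B i j)" for i j
      unfolding B_def[abs_def] by (rule ci[OF continuous_differentiable[OF V2]])
    have "{x. \<exists>j. f j x \<noteq> 0} \<subseteq> closure {x. V x \<noteq> 0}"
      using closure_subset by (force simp: f_def)
    then show "bounded {x. \<exists>j. f j x \<noteq> 0}"
      using V by (auto simp: compactly_supported_normal_field_def intro: bounded_subset compact_imp_bounded)
    show "H l i j x = H i l j x" for l i j x
      by (rule mixed_dir_derivs_commute[OF df dB df dB cH cH])
  qed (fact df dB cH)+
  have hw: "hel_weight lam x = (S.w x)\<^sup>2" for x
    unfolding hel_weight_def S.w_sq S.r_def y_def by (simp add: power2_eq_square)
  \<comment> \<open>Orthogonality to \<partial>F/\<partial>s, which is (y, 1) in the frame,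
    determines the vertical component.\<close>
  have sndV: "snd (V x) = - S.z x" for x
    using V0[of x "axis None 1"] by (simp add: inner_dhel_None S.z_def y_def f_def)
  have sndDV: "snd (DV (v i) x) = - (S.b i x + f i x)" for i x
  proof -
    have s: "A \<bullet> (0 :: complex^'k, 1 :: real) = snd A" for A by (cases A) simp
    have "has_dir_deriv (\<lambda>x. snd (V x)) (\<lambda>x. snd (DV (v i) x)) (v i)"
      using has_dir_deriv_inner[of V "\<lambda>_. (0, 1)" "v i", OF V1 refl] by (simp add: s DV_def)
    moreover have "has_dir_deriv (\<lambda>x. snd (V x)) (\<lambda>x. 0 - (f i x + S.b i x)) (v i)"
      unfolding sndV using has_dir_deriv_diff[OF has_dir_deriv_const[of 0] S.deriv_z] by simp
    ultimately show ?thesis using has_dir_deriv_unique by fastforce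
  qed
  have conn: "(norm (normal_connection (helicoid lam) V x (axis (Some i) 1)))\<^sup>2 = (lam $ i)\<^sup>2 * S.grad_sq i x" for i x
  proof -
    have ax: "axis (Some i) 1 = lam $ i *\<^sub>R v i" using pos[of i] by (simp add: v_def vec_eq_iff axis_def)
    have "linear (frechet_derivative V (at x))" by (rule linear_frechet_derivative[OF V1])
    then have A: "frechet_derivative V (at x) (axis (Some i) 1) = lam $ i *\<^sub>R DV (v i) x"
      unfolding ax DV_def by (rule linear_scale)
    \<comment> \<open>The product of \<open>V\<close> with a ruling direction vanishes identically,
      and that direction is constant along \<open>v i\<close>, so the derivative of \<open>V\<close>
      is orthogonal to it too.\<close>
    have E: "DV (v i) x \<bullet> dhel lam x (axis (Some j) 1) = 0" for j
    proof -
      have "has_dir_deriv (\<lambda>x. V x \<bullet> dhel lam x (axis (Some j) 1)) (\<lambda>x. DV (v i) x \<bullet> dhel lam x (axis (Some j) 1)) (v i)"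
        unfolding DV_def by (rule has_dir_deriv_inner[OF V1]) (simp add: dhel_Some rot_def vN del: vector_add_component)
      moreover have "has_dir_deriv (\<lambda>x. V x \<bullet> dhel lam x (axis (Some j) 1)) (\<lambda>x. 0) (v i)"
        unfolding V0 by (rule has_dir_deriv_const)
      ultimately show ?thesis by (rule has_dir_deriv_unique)
    qed
    have "DV (v i) x \<bullet> dhel lam x (axis None 1) = - f i x"
      by (simp add: inner_dhel_None sndDV S.b_def y_def B_def mult_ac)
    moreover have "DV (v i) x \<bullet> DV (v i) x = (\<Sum>j\<in>UNIV. (B i j x)\<^sup>2) + (S.b i x + f i x)\<^sup>2"
      using norm_sq_frame[OF E] by (simp add: B_def sndDV power2_eq_square algebra_simps)
    ultimately have "(norm (normal_part (helicoid lam) x (DV (v i) x)))\<^sup>2 = S.grad_sq i x"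
      unfolding normal_part_norm[OF E] hw S.grad_sq_def
      using S.w_u[of x] S.w_pos[of x] by (simp add: S.u_def S.w_def power_divide)
    then show ?thesis
      unfolding normal_connection_def A
      by (simp add: linear_scale[OF linear_normal_part[OF helicoid_differentiable]] power_mult_distrib)
  qed
  define Q where "Q x = second_variation_density (helicoid lam) V x (SOME e. orthonormal_frame_at (helicoid lam) x e)
     * volume_density (helicoid lam) x" for x
  have Qlow: "Q x \<ge> S.w x * (\<Sum>i\<in>UNIV. (lam $ i)\<^sup>2 * S.grad_sq i x) - 2 * \<Lambda> * (S.u x * S.ff x)" for x
  proof -
    define e where "e = (SOME e. orthonormal_frame_at (helicoid lam) x e)"
    have e: "orthonormal_frame_at (helicoid lam) x e" unfolding e_def by (rule orthonormal_frame_helicoid_some)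
    have w: "S.w x > 0" by (rule S.w_pos)
    have vol: "volume_density (helicoid lam) x = S.w x" using w by (simp add: volume_density_helicoid hw)
    have "(\<Sum>j\<in>UNIV. (lam $ j * f j x)\<^sup>2) \<le> \<Lambda> * S.ff x"
      unfolding S.ff_def sum_distrib_left
      by (intro sum_mono) (simp add: power_mult_distrib power2_eq_square[of "f _ x"] mult_right_mono \<Lambda>)
    then have "2 * (\<Sum>j\<in>UNIV. (lam $ j * f j x)\<^sup>2) / (S.w x)\<^sup>2 \<le> 2 * (\<Lambda> * S.ff x) / (S.w x)\<^sup>2"
      by (intro divide_right_mono mult_left_mono) auto
    then have "(\<Sum>i\<in>UNIV. (lam $ i)\<^sup>2 * S.grad_sq i x) - 2 * (\<Lambda> * S.ff x) / (S.w x)\<^sup>2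
        \<le> second_variation_density (helicoid lam) V x e"
      unfolding second_variation_density_def second_fundamental_form_sum[OF e nrm] hw
      using normal_connection_sum[OF e V1] by (simp add: conn f_def)
    then have "((\<Sum>i\<in>UNIV. (lam $ i)\<^sup>2 * S.grad_sq i x) - 2 * (\<Lambda> * S.ff x) / (S.w x)\<^sup>2) * S.w x \<le> Q x"
      unfolding Q_def vol e_def[symmetric] using w by (intro mult_right_mono) auto
    moreover have "2 * (\<Lambda> * S.ff x) / (S.w x)\<^sup>2 * S.w x = 2 * \<Lambda> * (S.u x * S.ff x)"
      using w by (simp add: S.u_def S.w_def[symmetric] power2_eq_square)
    ultimately show ?thesis by (simp only: right_diff_distrib mult.commute[of _ "S.w x"])
  qed
  have Kint: "integrable lborel (\<lambda>x. S.u x * S.ff x)"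
  proof (rule integrable_bounded_support)
    show "continuous_on UNIV (\<lambda>x. S.u x * S.ff x)" by (intro continuous_intros S.conts)
    show "bounded {x. S.u x * S.ff x \<noteq> 0}"
    proof (rule bounded_subset[OF S.supp], rule subsetI)
      fix x assume "x \<in> {x. S.u x * S.ff x \<noteq> 0}"
      then have "S.ff x \<noteq> 0" by simp
      then show "x \<in> {x. \<exists>j. f j x \<noteq> 0}" using S.f_0(1)[of x] by blast
    qed
  qed
  define K where "K = (LINT x|lborel. S.u x * S.ff x)"
  have bound: "- \<epsilon> * K \<le> second_variation (helicoid lam) V" if int: "integrable lborel Q" and \<epsilon>: "\<epsilon> > 0" for \<epsilon>
  proof -
    let ?C = "((real CARD('k) - 1)\<^sup>2 + 4) / 4"
    obtain \<sigma> \<tau> bt where st: "0 \<le> \<sigma>" "\<sigma> \<le> L" "0 \<le> \<tau>"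
      "\<forall>j. ((lam $ j)\<^sup>2 - \<sigma>) * (bt j + (bt j)\<^sup>2) \<le> \<tau>"
      "0 \<le> (\<Sum>j\<in>UNIV. ((lam $ j)\<^sup>2 - \<sigma>) * bt j) - \<tau>" (is "0 \<le> ?c")
      "2 * \<Lambda> - \<epsilon> \<le> ?C * \<sigma> + ((\<Sum>j\<in>UNIV. ((lam $ j)\<^sup>2 - \<sigma>) * bt j) - \<tau>)"
      by (rule scalar_mu_extract[OF sup \<epsilon> L])
    have a: "(lam $ j)\<^sup>2 - \<sigma> \<ge> 0" for j using L(2)[of j] st(2) by simp
    obtain g where g: "null_integral g"
      "\<forall>x. S.w x * (\<Sum>i\<in>UNIV. ((lam $ i)\<^sup>2 - \<sigma> + \<sigma>) * S.grad_sq i x)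
        \<ge> g x + ?c * (S.u x * (S.ff x + (S.z x)\<^sup>2)) + \<sigma> * ?C * (S.u x * S.ff x)"
      by (rule S.hardy_lower_bound[where a = "\<lambda>j. (lam $ j)\<^sup>2 - \<sigma>" and bt = bt, OF k3 a st(4)[rule_format] st(3) st(1)])
    have "g x - \<epsilon> * (S.u x * S.ff x) \<le> Q x" for x
    proof -
      have E: "S.u x * S.ff x \<ge> 0" using S.u_pos[of x] by (simp add: S.ff_def sum_nonneg)
      \<comment> \<open>The term with z^2 may be dropped because \<open>?c\<close> is
        nonnegative.\<close>
      have "?c * (S.u x * S.ff x) \<le> ?c * (S.u x * (S.ff x + (S.z x)\<^sup>2))"
        using st(5) S.u_pos[of x] by (intro mult_left_mono) auto
      moreover have "(2 * \<Lambda> - \<epsilon>) * (S.u x * S.ff x) \<le> (?C * \<sigma> + ?c) * (S.u x * S.ff x)"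
        using st(6) E by (intro mult_right_mono) auto
      ultimately show ?thesis using Qlow[of x] g(2)[rule_format, of x] by (simp add: algebra_simps)
    qed
    then have "(LINT x|lborel. g x - \<epsilon> * (S.u x * S.ff x)) \<le> integral\<^sup>L lborel Q"
      using g(1) Kint int by (intro integral_mono) (auto simp: null_integral_def)
    moreover have "(LINT x|lborel. g x - \<epsilon> * (S.u x * S.ff x)) = - \<epsilon> * K"
      using g(1) Kint by (simp add: null_integral_def K_def)
    ultimately show ?thesis by (simp add: second_variation_def Q_def[abs_def])
  qed
  show "0 \<le> second_variation (helicoid lam) V"
  proof (cases "integrable lborel Q")
    case True
    have K: "K \<ge> 0" unfolding K_def
      by (intro Bochner_Integration.integral_nonneg mult_nonneg_nonneg less_imp_le[OF S.u_pos])
         (simp add: S.ff_def sum_nonneg)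
    show ?thesis
    proof (rule field_le_epsilon)
      fix d :: real assume d: "d > 0"
      have "K \<le> K + 1" by simp
      \<comment> \<open>The error is taken as d/(K + 1), which stays meaningful when K = 0.\<close>
      then have "d / (K + 1) * K \<le> d" using d K by (simp add: divide_le_eq field_simps)
      then show "0 \<le> second_variation (helicoid lam) V + d"
        using bound[OF True, of "d / (K + 1)"] d K by simp
    qed
  next
    \<comment> \<open>For a non-integrable integrand the integral is 0 by convention, and the claim
      is immediate.\<close>
    case False
    then show ?thesis by (simp add: second_variation_def Q_def[abs_def] not_integrable_integral_eq)
  qed
qed

theorem theorem7p1:
  fixes lam :: "real^'k" and lam_min lam_max :: real
  assumes "CARD('k) \<ge> 3"
    and "\<And>j. lam $ j > 0"
    and "lam_min = Min (range (\<lambda>j. lam $ j))"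
    and "lam_max = Max (range (\<lambda>j. lam $ j))"
    and "(SUP \<sigma>\<in>{0..lam_min\<^sup>2}.
            ((real CARD('k) - 1)\<^sup>2 + 4) / 4 * \<sigma> + mu (\<chi> j. sqrt ((lam $ j)\<^sup>2 - \<sigma>)))
          \<ge> 2 * lam_max\<^sup>2"
  shows "stable_submanifold (helicoid lam)"
proof -
  have "lam_min \<in> range (\<lambda>j. lam $ j)" unfolding assms(3) by (intro Min_in) auto
  then have "lam_min \<ge> 0" using assms(2) less_imp_le by auto
  moreover have "lam_min \<le> lam $ j" "lam $ j \<le> lam_max" for j
    unfolding assms(3,4) by auto
  ultimately show ?thesis
    using assms(2) by (intro helicoid_stable[OF assms(1,2) _ _ _ assms(5)] power_mono) (auto simp: less_imp_le)
qed

end
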